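(* A subgroupoid $(D,\circ)$ of the groupoid $(\mathbb D^n,\circ)$ is finitely generated if and only if it is isomorphic (as a groupoid) to a semipolytope.
   Context: $\mathbb D=\mathbb Z[1/2]$ is the ring of dyadic rationals, $\mathbb D^m\subseteq\mathbb R^m$, and $x\circ y=\tfrac12(x+y)$. A subgroupoid is a subset closed under $\circ$; it is finitely generated if it is the smallest $\circ$-closed set containing some finite set. Isomorphism means a bijection preserving $\circ$. A dyadic polytope is a set $C=Q\cap\mathbb D^m$, where $Q\subseteq\mathbb R^m$ is a real convex polytope whose vertices all lie in $\mathbb D^m$; then $Q=\mathrm{conv}_{\mathbb R}(C)$ is the real convex hull of $C$, and the vertices of $C$ are the vertices of $Q$. For a subgroupoid $C\subseteq\mathbb D^m$, $\mathrm{aff}_{\mathbb D}(C)$ is the set of all finite combinations $\sum x_ir_i$ with $x_i\in C$, $r_i\in\mathbb D$, $\sum r_i=1$, and $\mathrm{int}(C)$ is the intersection of $\mathrm{aff}_{\mathbb D}(C)$ with the relative interior of $\mathrm{conv}_{\mathbb R}(C)$. A vertex of a subgroupoid $S$ is a one-element wall, i.e. a point $v\in S$ such that for all $a,b\in S$: $a\circ b=v$ iff $a=b=v$. A semipolytope is a subgroupoid $S$ of a dyadic polytope $C$ such that $S$ and $C$ have the same vertices and $S\cap\mathrm{int}(C)=\mathrm{int}(C)$ (i.e. $S$ contains all interior points of $C$). *)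

theory Defs
  imports "HOL-Analysis.Analysis" "HOL-Library.Function_Algebras"
begin

(* Since the dimension m of the dyadic space containing a semipolytope is existentially
   quantified, all the spaces R^m live in the one type nat => real: as in the library's
   Euclidean_space m, R^m consists of the functions vanishing outside {..<m}. The functions
   carry the pointwise vector space structure and the library's product topology, which
   induces the Euclidean topology on every R^m. *)

instantiation "fun" :: (type, real_vector) real_vector
begin

definition scaleR_fun_def: "c *\<^sub>R f = (\<lambda>x. c *\<^sub>R f x)"

instance
  by standard (auto simp: scaleR_fun_def plus_fun_def algebra_simps)

end

lemma scaleR_fun_apply [simp]: "(c *\<^sub>R f) x = c *\<^sub>R f x"
  by (simp add: scaleR_fun_def)

(* The ring Z[1/2]; the library's constant dyadics has only its nonnegative elements. *)
definition dyadic_rationals :: "real set" where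
  "dyadic_rationals = {of_int a / 2 ^ k | a k. True}"

definition dyadic_space :: "nat \<Rightarrow> (nat \<Rightarrow> real) set" where
  "dyadic_space m = {x \<in> topspace (Euclidean_space m). \<forall>i<m. x i \<in> dyadic_rationals}"

(* The groupoid operation is the library's midpoint. *)

definition midpoint_closed :: "'a::real_vector set \<Rightarrow> bool" where
  "midpoint_closed S \<longleftrightarrow> (\<forall>a\<in>S. \<forall>b\<in>S. midpoint a b \<in> S)"

definition subgroupoid :: "'a::real_vector set \<Rightarrow> 'a set \<Rightarrow> bool" where
  "subgroupoid S T \<longleftrightarrow> S \<subseteq> T \<and> midpoint_closed S"

definition finitely_generated :: "'a::real_vector set \<Rightarrow> bool" where
  "finitely_generated S \<longleftrightarrow> (\<exists>X. finite X \<and> S = midpoint_closed hull X)"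

definition groupoid_isomorphic :: "'a::real_vector set \<Rightarrow> 'b::real_vector set \<Rightarrow> bool" where
  "groupoid_isomorphic S T \<longleftrightarrow>
    (\<exists>f. bij_betw f S T \<and> (\<forall>a\<in>S. \<forall>b\<in>S. f (midpoint a b) = midpoint (f a) (f b)))"

definition groupoid_vertices :: "'a::real_vector set \<Rightarrow> 'a set" where
  "groupoid_vertices S = {v \<in> S. \<forall>a\<in>S. \<forall>b\<in>S. midpoint a b = v \<longleftrightarrow> a = v \<and> b = v}"

definition dyadic_aff :: "'a::real_vector set \<Rightarrow> 'a set" where
  "dyadic_aff C = {\<Sum>x\<in>X. r x *\<^sub>R x | X r.
     finite X \<and> X \<subseteq> C \<and> (\<forall>x\<in>X. r x \<in> dyadic_rationals) \<and> sum r X = 1}"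

definition dyadic_int :: "(nat \<Rightarrow> real) set \<Rightarrow> (nat \<Rightarrow> real) set" where
  "dyadic_int C = dyadic_aff C \<inter> rel_interior (convex hull C)"

definition dyadic_polytope :: "nat \<Rightarrow> (nat \<Rightarrow> real) set \<Rightarrow> bool" where
  "dyadic_polytope m C \<longleftrightarrow>
    (\<exists>Q. Q \<subseteq> topspace (Euclidean_space m) \<and> polytope Q \<and>
         {v. v extreme_point_of Q} \<subseteq> dyadic_space m \<and> C = Q \<inter> dyadic_space m)"

(* The vertices of S are taken in the groupoid S, whereas those of the dyadic polytope C are
   the vertices of the real polytope convex hull C. The empty set is a subgroupoid, generated
   by the empty set, and it is also a (dyadic) polytope and a semipolytope. *)
definition semipolytope :: "nat \<Rightarrow> (nat \<Rightarrow> real) set \<Rightarrow> bool" where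
  "semipolytope m S \<longleftrightarrow>
    (\<exists>C. dyadic_polytope m C \<and> subgroupoid S C \<and>
         groupoid_vertices S = {v. v extreme_point_of (convex hull C)} \<and>
         S \<inter> dyadic_int C = dyadic_int C)"

end

theory Submission
  imports Defs
begin

text \<open>
  A midpoint-closed set is closed under convex combinations with dyadic weights, so the groupoid
  generated by a finite set \<open>X\<close> of dyadic points consists of the averages of \<open>X\<close> with weights in the
  dyadic rationals. The decisive fact, \<open>positive_dyadic_affine_combination_in_hull\<close>, is that on the
  relative interior of the convex hull of \<open>X\<close> nothing obstructs generation except arithmetic: a
  relatively interior point is generated as soon as it is an affine combination of \<open>X\<close> with dyadic
  coefficients of any sign. It rests on the fact that positive real solutions of homogeneous linear
  equations with dyadic coefficients can be replaced by positive integer solutions, which follows from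
  Dirichlet's simultaneous approximation theorem (\<open>positive_combination_integral\<close>).

  Let \<open>D\<close> be generated by a finite set \<open>X\<close>. The differences of points of \<open>X\<close> span a submodule of a free
  module over the principal ideal domain of dyadic rationals, and so this submodule is free
  (\<open>dyadic_submodule_free\<close>). Coordinates with respect to a basis embed \<open>D\<close> into some dyadic space
  in such a way that the image \<open>Y\<close> of \<open>X\<close> spans this space affinely. Then all interior dyadic
  points of the convex hull of \<open>Y\<close> are generated. The vertices of the groupoid are those of the
  polytope, since the same approximation argument turns a nontrivial real convex combination equal
  to a vertex of the groupoid into a nontrivial dyadic one
  (\<open>groupoid_vertices_midpoint_closed_hull\<close>). So the image of \<open>D\<close> is a
  semipolytope (\<open>semipolytope_hull\<close>).

  Conversely, a semipolytope \<open>S\<close> contains the vertices \<open>V\<close> of a polytope that contains \<open>S\<close>. For each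
  \<open>W \<subseteq> V\<close> consider the points of \<open>S\<close> in the relative interior of the convex hull of \<open>W\<close>. Dyadic
  spaces are Noetherian (\<open>finite_subset_dyadic_aff\<close>), so finitely many of these points, together
  with \<open>W\<close>, suffice to represent all of them as dyadic affine combinations, and by the decisive fact
  they generate all of them. As there are only finitely many sets \<open>W\<close>, and their relative interiors
  cover \<open>S\<close>, the groupoid \<open>S\<close> is finitely generated (\<open>finitely_generated_in_convex_hull\<close>).
\<close>

section \<open>Dyadic rationals and dyadic spaces\<close>

lemma dyadic_of_int_div: "of_int a / 2 ^ k \<in> dyadic_rationals"
  by (auto simp: dyadic_rationals_def)

lemma dyadic_of_int [simp]: "of_int a \<in> dyadic_rationals"
  using dyadic_of_int_div[of a 0] by simp

lemma dyadic_0 [simp]: "0 \<in> dyadic_rationals" and dyadic_1 [simp]: "1 \<in> dyadic_rationals"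
  using dyadic_of_int[of 0] dyadic_of_int[of 1] by simp_all

lemma dyadic_half: "x \<in> dyadic_rationals \<Longrightarrow> x / 2 \<in> dyadic_rationals"
proof -
  assume "x \<in> dyadic_rationals"
  then obtain a k where "x = of_int a / 2 ^ k" by (auto simp: dyadic_rationals_def)
  then have "x / 2 = of_int a / 2 ^ Suc k" by simp
  then show ?thesis by (metis dyadic_of_int_div)
qed

lemma dyadic_diff: 
  assumes "x \<in> dyadic_rationals" "y \<in> dyadic_rationals"
  shows "x - y \<in> dyadic_rationals"
proof -
  obtain a k b l where "x = of_int a / 2 ^ k" "y = of_int b / 2 ^ l"
    using assms by (auto simp: dyadic_rationals_def)
  then have "x - y = of_int (a * 2 ^ l - b * 2 ^ k) / 2 ^ (k + l)"
    by (simp add: diff_divide_distrib power_add)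
  then show ?thesis by (metis dyadic_of_int_div)
qed

lemma dyadic_add: "x \<in> dyadic_rationals \<Longrightarrow> y \<in> dyadic_rationals \<Longrightarrow> x + y \<in> dyadic_rationals"
  using dyadic_diff[of x "0 - y"] dyadic_diff[of 0 y] by simp

lemma dyadic_mult:
  assumes "x \<in> dyadic_rationals" "y \<in> dyadic_rationals"
  shows "x * y \<in> dyadic_rationals"
proof -
  obtain a k b l where "x = of_int a / 2 ^ k" "y = of_int b / 2 ^ l"
    using assms by (auto simp: dyadic_rationals_def)
  then have "x * y = of_int (a * b) / 2 ^ (k + l)"
    by (simp add: power_add)
  then show ?thesis by (metis dyadic_of_int_div)
qed

lemma dyadic_sum: "(\<And>x. x \<in> A \<Longrightarrow> f x \<in> dyadic_rationals) \<Longrightarrow> sum f A \<in> dyadic_rationals"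
  by (induction A rule: infinite_finite_induct) (auto intro: dyadic_add)

lemma dyadic_common_denominator:
  assumes "finite A" "\<And>x. x \<in> A \<Longrightarrow> f x \<in> dyadic_rationals"
  obtains k :: nat and b where "\<And>x. x \<in> A \<Longrightarrow> 2 ^ k * f x = of_int (b x)"
proof -
  have "\<exists>k::nat. \<forall>x\<in>A. 2 ^ k * f x \<in> \<int>"
    using assms
  proof (induction A rule: finite_induct)
    case (insert y A)
    obtain k where k: "\<forall>x\<in>A. 2 ^ k * f x \<in> \<int>" using insert by auto
    obtain a l where y: "f y = of_int a / 2 ^ l"
      using insert.prems[of y] by (auto simp: dyadic_rationals_def)
    have "2 ^ (k + l) * f x \<in> \<int>" if "x \<in> A" for x
    proof -
      have "2 ^ (k + l) * f x = 2 ^ l * (2 ^ k * f x)" by (simp add: power_add)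
      moreover have "2 ^ k * f x \<in> \<int>" using k that by blast
      ultimately show ?thesis by (metis Ints_mult Ints_numeral Ints_power)
    qed
    moreover have "2 ^ (k + l) * f y \<in> \<int>"
      by (simp add: y power_add Ints_mult Ints_power)
    ultimately show ?case by (intro exI[of _ "k + l"]) auto
  qed auto
  then obtain k :: nat where "\<forall>x\<in>A. \<exists>b. 2 ^ k * f x = of_int b"
    unfolding Ints_def by blast
  then show ?thesis using that by metis
qed

lemma sum_apply: "(\<Sum>x\<in>A. f x) i = (\<Sum>x\<in>A. f x i)" for f :: "_ \<Rightarrow> _ \<Rightarrow> real"
  by (induction A rule: infinite_finite_induct) auto

lemma dyadic_space_iff:
  "x \<in> dyadic_space m \<longleftrightarrow> (\<forall>i\<ge>m. x i = 0) \<and> (\<forall>i. x i \<in> dyadic_rationals)"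
proof -
  have "x i \<in> dyadic_rationals" if "\<forall>i\<ge>m. x i = 0" "\<forall>i<m. x i \<in> dyadic_rationals" for i
    using that by (cases "i < m") auto
  then show ?thesis by (auto simp: dyadic_space_def topspace_Euclidean_space)
qed

lemma midpoint_apply: "midpoint x y i = (x i + y i) / 2" for x y :: "nat \<Rightarrow> real"
  by (simp add: midpoint_def)

lemma midpoint_closed_dyadic_space: "midpoint_closed (dyadic_space m)"
  by (auto simp: midpoint_closed_def dyadic_space_iff midpoint_apply
      intro!: dyadic_half dyadic_add)

section \<open>Averages in groupoids\<close>

lemma midpoint_closed_hull: "midpoint_closed (midpoint_closed hull X)"
  by (rule hull_in) (auto simp: midpoint_closed_def)

lemma exists_subfunction_with_sum:
  fixes c :: "'a \<Rightarrow> nat"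
  assumes "N \<le> sum c Y"
  obtains d where "\<And>x. d x \<le> c x" "sum d Y = N"
proof -
  have "\<exists>d. (\<forall>x. d x \<le> c x) \<and> sum d Y = N"
    using assms
  proof (induction N)
    case 0
    then show ?case by (intro exI[of _ "\<lambda>_. 0"]) auto
  next
    case (Suc N)
    then obtain d where d: "\<forall>x. d x \<le> c x" "sum d Y = N" by auto
    have "\<exists>y\<in>Y. d y < c y"
    proof (rule ccontr)
      assume "\<not> ?thesis"
      then have "sum c Y \<le> sum d Y" by (intro sum_mono) (auto simp: not_less)
      then show False using d Suc.prems by simp
    qed
    then obtain y where y: "y \<in> Y" "d y < c y" by blast
    have "finite Y" using Suc.prems by (metis not_less_eq_eq sum.infinite le0)
    then have "sum (d(y := Suc (d y))) Y = Suc N"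
      using y d by (simp add: sum.remove[of Y y])
    then show ?case using d y by (intro exI[of _ "d(y := Suc (d y))"]) (auto simp: Suc_le_eq)
  qed
  then show ?thesis using that by blast
qed

text \<open>
  A weighted average whose weights have the denominator \<open>2 ^ Suc k\<close> is the midpoint of two
  averages with denominator \<open>2 ^ k\<close>: the numerators can be split into two parts of equal size.
\<close>

lemma weights_halve:
  fixes c :: "'a::real_vector \<Rightarrow> nat"
  assumes "sum c Y = 2 ^ Suc k"
  obtains d e where "sum d Y = 2 ^ k" "sum e Y = 2 ^ k" "\<And>x. c x = d x + e x"
    "(1 / 2 ^ Suc k) *\<^sub>R (\<Sum>x\<in>Y. real (c x) *\<^sub>R x) =
      midpoint ((1 / 2 ^ k) *\<^sub>R (\<Sum>x\<in>Y. real (d x) *\<^sub>R x)) ((1 / 2 ^ k) *\<^sub>R (\<Sum>x\<in>Y. real (e x) *\<^sub>R x))"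
proof -
  obtain d where d: "\<And>x. d x \<le> c x" "sum d Y = 2 ^ k"
    using exists_subfunction_with_sum[of "2 ^ k" c Y] assms by auto
  define e where "e x = c x - d x" for x
  have c: "c x = d x + e x" for x using d(1)[of x] by (simp add: e_def)
  have "sum c Y = sum d Y + sum e Y" by (simp add: c sum.distrib)
  then have e: "sum e Y = 2 ^ k" using d assms by simp
  show ?thesis
    by (rule that[OF d(2) e c])
      (simp add: c midpoint_def scaleR_add_left sum.distrib scaleR_add_right)
qed

text \<open>
  By induction on the exponent: a set closed under midpoints contains all convex combinations of
  its points with dyadic weights.
\<close>

lemma midpoint_closed_average:
  assumes "midpoint_closed S" "Y \<subseteq> S" "finite Y" "sum c Y = 2 ^ k"
  shows "(1 / 2 ^ k) *\<^sub>R (\<Sum>x\<in>Y. real (c x) *\<^sub>R x) \<in> S"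
  using assms(4)
proof (induction k arbitrary: c)
  case 0
  then obtain y where y: "y \<in> Y" "c y = 1" "\<And>x. x \<in> Y \<Longrightarrow> x \<noteq> y \<Longrightarrow> c x = 0"
    using sum_eq_1_iff[OF assms(3), of c] by auto
  have "(\<Sum>x\<in>Y. real (c x) *\<^sub>R x) = y"
    using y assms(3) by (simp add: sum.remove[of Y y])
  then show ?case using y assms(2) by auto
next
  case (Suc k)
  obtain d e where "sum d Y = 2 ^ k" "sum e Y = 2 ^ k" "\<And>x. c x = d x + e x"
    "(1 / 2 ^ Suc k) *\<^sub>R (\<Sum>x\<in>Y. real (c x) *\<^sub>R x) =
      midpoint ((1 / 2 ^ k) *\<^sub>R (\<Sum>x\<in>Y. real (d x) *\<^sub>R x)) ((1 / 2 ^ k) *\<^sub>R (\<Sum>x\<in>Y. real (e x) *\<^sub>R x))"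
    by (rule weights_halve[OF Suc.prems]) (rule that)
  then show ?case using Suc.IH assms(1) by (auto simp: midpoint_closed_def)
qed

text \<open>
  Midpoints can reach a vertex only from the vertex itself; halving the weights repeatedly extends
  this to all dyadic averages.
\<close>

lemma groupoid_vertex_average:
  assumes "midpoint_closed S" "Y \<subseteq> S" "finite Y" "sum c Y = 2 ^ k" "v \<in> groupoid_vertices S"
    and "(1 / 2 ^ k) *\<^sub>R (\<Sum>x\<in>Y. real (c x) *\<^sub>R x) = v" "y \<in> Y" "c y > 0"
  shows "y = v"
  using assms(4,6,8)
proof (induction k arbitrary: c)
  case 0
  then obtain z where z: "z \<in> Y" "c z = 1" "\<And>x. x \<in> Y \<Longrightarrow> x \<noteq> z \<Longrightarrow> c x = 0"
    using sum_eq_1_iff[OF assms(3), of c] by auto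
  then have "y = z" using 0(3) assms(7) by force
  then have "(\<Sum>x\<in>Y. real (c x) *\<^sub>R x) = y"
    using z assms(3) by (simp add: sum.remove[of Y y])
  then show ?case using 0 by simp
next
  case (Suc k)
  obtain d e where de: "sum d Y = 2 ^ k" "sum e Y = 2 ^ k"
    "\<And>x. c x = d x + e x"
    "(1 / 2 ^ Suc k) *\<^sub>R (\<Sum>x\<in>Y. real (c x) *\<^sub>R x) =
      midpoint ((1 / 2 ^ k) *\<^sub>R (\<Sum>x\<in>Y. real (d x) *\<^sub>R x)) ((1 / 2 ^ k) *\<^sub>R (\<Sum>x\<in>Y. real (e x) *\<^sub>R x))"
    by (rule weights_halve[OF Suc.prems(1)]) (rule that)
  have "(1 / 2 ^ k) *\<^sub>R (\<Sum>x\<in>Y. real (d x) *\<^sub>R x) \<in> S" "(1 / 2 ^ k) *\<^sub>R (\<Sum>x\<in>Y. real (e x) *\<^sub>R x) \<in> S"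
    using de midpoint_closed_average[OF assms(1-3)] by blast+
  then have "(1 / 2 ^ k) *\<^sub>R (\<Sum>x\<in>Y. real (d x) *\<^sub>R x) = v" "(1 / 2 ^ k) *\<^sub>R (\<Sum>x\<in>Y. real (e x) *\<^sub>R x) = v"
    using assms(5) de(4) Suc.prems(2) by (auto simp: groupoid_vertices_def)
  then show ?case
    using Suc.IH[OF de(1)] Suc.IH[OF de(2)] de(3) Suc.prems(3) by auto
qed

section \<open>Integrality of positive combinations\<close>

text \<open>
  For finite \<open>Y\<close> this is the relative interior of the convex hull of \<open>Y\<close>, in a form that gives
  access to the weights.
\<close>

definition positive_combinations :: "'a::real_vector set \<Rightarrow> 'a set" where
  "positive_combinations Y = {\<Sum>x\<in>Y. t x *\<^sub>R x | t. (\<forall>x\<in>Y. 0 < t x) \<and> sum t Y = 1}"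

text \<open>
  The relation \<open>v = (\<Sum>y\<in>Y. t y *\<^sub>R y)\<close> is a homogeneous linear system for the weights, in which the
  coefficients \<open>y i - v i\<close> are integers after multiplication by a power of two. By Dirichlet's
  simultaneous approximation theorem some positive multiple of the weight vector is close to an
  integer vector \<open>a\<close>. If it is close enough, the integer vector is still positive, and it violates
  each equation by an integer of absolute value less than one, hence not at all.
\<close>

lemma positive_combination_integral:
  assumes "finite Y" "Y \<subseteq> dyadic_space m" "v \<in> dyadic_space m" "v \<in> positive_combinations Y"
  obtains a :: "_ \<Rightarrow> nat" where "\<And>y. y \<in> Y \<Longrightarrow> a y > 0"
    "(\<Sum>y\<in>Y. real (a y) *\<^sub>R y) = real (sum a Y) *\<^sub>R v"
proof -
  obtain t where t: "\<And>y. y \<in> Y \<Longrightarrow> 0 < t y" "sum t Y = 1" "v = (\<Sum>y\<in>Y. t y *\<^sub>R y)"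
    using assms(4) by (auto simp: positive_combinations_def)
  have "y i - v i \<in> dyadic_rationals" if "y \<in> Y" for y i
    using that assms(2,3) by (intro dyadic_diff) (auto simp: dyadic_space_iff)
  then obtain k :: nat and c
    where c: "\<And>p. p \<in> Y \<times> {..<m} \<Longrightarrow> 2 ^ k * (case p of (y, i) \<Rightarrow> y i - v i) = of_int (c p)"
    using dyadic_common_denominator[of "Y \<times> {..<m}" "\<lambda>(y, i). y i - v i"] assms(1)
    by (metis (no_types, lifting) SigmaE case_prod_conv finite_SigmaI finite_lessThan)
  define b where "b y i = c (y, i)" for y i
  have b: "2 ^ k * (y i - v i) = of_int (b y i)" if "y \<in> Y" "i < m" for y i
    using c[of "(y, i)"] that by (simp add: b_def)
  have relation: "(\<Sum>y\<in>Y. t y * of_int (b y i)) = 0" if "i < m" for i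
  proof -
    have v: "(\<Sum>y\<in>Y. t y * y i) = v i" by (simp add: t(3) sum_apply)
    have "(\<Sum>y\<in>Y. t y * of_int (b y i)) = (\<Sum>y\<in>Y. 2 ^ k * (t y * y i - t y * v i))"
      using that by (intro sum.cong) (auto simp: algebra_simps simp flip: b)
    also have "\<dots> = 2 ^ k * ((\<Sum>y\<in>Y. t y * y i) - (\<Sum>y\<in>Y. t y) * v i)"
      by (simp add: sum_subtractf sum_distrib_right flip: sum_distrib_left)
    finally show ?thesis by (simp add: v t(2))
  qed
  define B where "B = (\<Sum>i<m. \<Sum>y\<in>Y. \<bar>real_of_int (b y i)\<bar>)"
  have "0 \<le> B" by (auto simp: B_def intro!: sum_nonneg)
  \<comment> \<open>The bound \<open>1 / N\<close> on the approximation error has to be below every weight, so that the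
     approximants are positive, and so small that the errors in an equation, whose coefficients have
     absolute values of sum at most \<open>B\<close>, add up to less than one.\<close>
  obtain N :: nat where N_gt: "B + (\<Sum>y\<in>Y. 1 / t y) < real N" using reals_Archimedean2 by blast
  have inverse_le: "1 / t y \<le> (\<Sum>y\<in>Y. 1 / t y)" if "y \<in> Y" for y
    using that assms(1) t(1) by (intro member_le_sum) (auto simp: less_imp_le)
  have "0 \<le> (\<Sum>y\<in>Y. 1 / t y)" using t(1) by (auto intro!: sum_nonneg simp: less_imp_le)
  then have N: "N > 0" "B < real N"
    using N_gt \<open>0 \<le> B\<close> by (auto intro: Nat.gr0I)
  have N_inverse: "1 / real N < t y" if y: "y \<in> Y" for y
  proof -
    have "1 / t y < real N" using inverse_le[OF y] N_gt \<open>0 \<le> B\<close> by simp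
    then show ?thesis using t(1)[OF y] N(1) by (simp add: field_simps)
  qed
  obtain h where h: "bij_betw h {..<card Y} Y"
    using ex_bij_betw_nat_finite[OF assms(1)] atLeast0LessThan by metis
  obtain q p where q: "q > 0"
    "\<And>i. i < card Y \<Longrightarrow> \<bar>of_int q * t (h i) - of_int (p i)\<bar> < 1 / real N"
    using Dirichlet_approx_simult[OF N(1), of "card Y" "t \<circ> h"] by (metis comp_apply)
  define g where "g = inv_into {..<card Y} h"
  define a where "a y = nat (p (g y))" for y
  have gh: "g y < card Y" "h (g y) = y" if "y \<in> Y" for y
    using that h inv_into_into[of y h "{..<card Y}"] f_inv_into_f[of y h "{..<card Y}"]
    by (auto simp: g_def bij_betw_def)
  have pos: "p (g y) > 0" and approx: "\<bar>of_int q * t y - of_int (p (g y))\<bar> < 1 / real N"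
    if y: "y \<in> Y" for y
  proof -
    show *: "\<bar>of_int q * t y - of_int (p (g y))\<bar> < 1 / real N"
      using q(2)[OF gh(1)[OF y]] gh(2)[OF y] by simp
    \<comment> \<open>As \<open>q \<ge> 1\<close>, the approximated number is at least \<open>t y\<close>, which exceeds the error.\<close>
    have "1 * t y \<le> of_int q * t y" using q(1) t(1)[OF y] by (intro mult_right_mono) auto
    then have "0 < real_of_int (p (g y))" using * N_inverse[OF y] by linarith
    then show "p (g y) > 0" by simp
  qed
  have a: "real (a y) = of_int (p (g y))" if "y \<in> Y" for y
    using pos[OF that] by (simp add: a_def)
  have zero: "(\<Sum>y\<in>Y. real (a y) * of_int (b y i)) = 0" if i: "i < m" for i
  proof -
    have "(\<Sum>y\<in>Y. real (a y) * of_int (b y i)) =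
        (\<Sum>y\<in>Y. (real (a y) - of_int q * t y) * of_int (b y i))"
      using relation[OF i] by (simp add: algebra_simps sum_subtractf flip: sum_distrib_left)
    also have "\<bar>\<dots>\<bar> \<le> (\<Sum>y\<in>Y. \<bar>(real (a y) - of_int q * t y) * of_int (b y i)\<bar>)"
      by (rule sum_abs)
    also have "\<dots> \<le> (\<Sum>y\<in>Y. (1 / real N) * \<bar>real_of_int (b y i)\<bar>)"
      unfolding abs_mult
      using approx by (intro sum_mono mult_right_mono) (auto simp: a abs_minus_commute less_imp_le)
    also have "\<dots> = (\<Sum>y\<in>Y. \<bar>real_of_int (b y i)\<bar>) / real N"
      by (simp add: sum_divide_distrib)
    also have "\<dots> \<le> B / real N"
      unfolding B_def using i
      by (intro divide_right_mono member_le_sum[where f="\<lambda>i. \<Sum>y\<in>Y. \<bar>real_of_int (b y i)\<bar>"])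
        (auto intro: sum_nonneg)
    also have "\<dots> < 1" using N by simp
    finally have "\<bar>(\<Sum>y\<in>Y. real (a y) * of_int (b y i))\<bar> < 1" .
    moreover have integer: "(\<Sum>y\<in>Y. real (a y) * of_int (b y i)) = of_int (\<Sum>y\<in>Y. int (a y) * b y i)"
      by simp
    ultimately have "(\<Sum>y\<in>Y. int (a y) * b y i) = 0" by linarith
    then show ?thesis unfolding integer by simp
  qed
  have "(\<Sum>y\<in>Y. real (a y) *\<^sub>R y) = real (sum a Y) *\<^sub>R v"
  proof
    fix i
    show "(\<Sum>y\<in>Y. real (a y) *\<^sub>R y) i = (real (sum a Y) *\<^sub>R v) i"
    proof (cases "i < m")
      case True
      have "2 ^ k * ((\<Sum>y\<in>Y. real (a y) * y i) - (\<Sum>y\<in>Y. real (a y)) * v i) =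
          (\<Sum>y\<in>Y. real (a y) * (2 ^ k * (y i - v i)))"
        by (simp add: algebra_simps sum_subtractf sum_distrib_left)
      also have "\<dots> = 0" using zero[OF True] b True by simp
      finally show ?thesis by (simp add: sum_apply)
    next
      case False
      then have "y i = 0" if "y \<in> Y" for y using assms(2) that by (auto simp: dyadic_space_iff)
      moreover have "v i = 0" using False assms(3) by (simp add: dyadic_space_iff)
      ultimately show ?thesis by (auto simp: sum_apply intro!: sum.neutral)
    qed
  qed
  then show ?thesis using that[of a] pos by (simp add: a_def)
qed

section \<open>Interior points of finitely generated groupoids\<close>

lemma dyadic_aff_finite:
  assumes "finite Y"
  shows "y \<in> dyadic_aff Y \<longleftrightarrow>
    (\<exists>r. (\<forall>x\<in>Y. r x \<in> dyadic_rationals) \<and> sum r Y = 1 \<and> y = (\<Sum>x\<in>Y. r x *\<^sub>R x))"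
proof
  assume "y \<in> dyadic_aff Y"
  then obtain X r where X: "X \<subseteq> Y" "\<forall>x\<in>X. r x \<in> dyadic_rationals" "sum r X = 1"
    "y = (\<Sum>x\<in>X. r x *\<^sub>R x)"
    by (auto simp: dyadic_aff_def)
  define s where "s x = (if x \<in> X then r x else 0)" for x
  have "sum s Y = sum r X" "(\<Sum>x\<in>Y. s x *\<^sub>R x) = (\<Sum>x\<in>X. r x *\<^sub>R x)"
    using X(1) assms by (auto simp: s_def intro!: sum.mono_neutral_cong_right)
  then show "\<exists>r. (\<forall>x\<in>Y. r x \<in> dyadic_rationals) \<and> sum r Y = 1 \<and> y = (\<Sum>x\<in>Y. r x *\<^sub>R x)"
    using X by (intro exI[of _ s]) (auto simp: s_def)
qed (use assms in \<open>auto simp: dyadic_aff_def\<close>)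

lemma dyadic_aff_mono: "X \<subseteq> Y \<Longrightarrow> dyadic_aff X \<subseteq> dyadic_aff Y"
  by (force simp: dyadic_aff_def)

lemma dyadic_aff_dyadic_space:
  assumes "Y \<subseteq> dyadic_space m"
  shows "dyadic_aff Y \<subseteq> dyadic_space m"
proof
  fix y assume "y \<in> dyadic_aff Y"
  then obtain X r where X: "X \<subseteq> Y" "\<forall>x\<in>X. r x \<in> dyadic_rationals" "y = (\<Sum>x\<in>X. r x *\<^sub>R x)"
    by (auto simp: dyadic_aff_def)
  then have "x \<in> dyadic_space m" if "x \<in> X" for x using assms that by blast
  then show "y \<in> dyadic_space m"
    using X(2) by (auto simp: X(3) dyadic_space_iff sum_apply intro!: sum.neutral dyadic_sum dyadic_mult)
qed

text \<open>
  Here lies the heart of the matter: a point that is both an affine combination with dyadic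
  coefficients (possibly negative) and a convex combination with positive real weights is an
  average with dyadic weights. Clearing denominators gives two relations
  \<open>N *\<^sub>R y = (\<Sum>x\<in>Y. a x *\<^sub>R x)\<close> with positive integers \<open>a x\<close> of sum \<open>N\<close>, and
  \<open>2 ^ k *\<^sub>R y = (\<Sum>x\<in>Y. b x *\<^sub>R x)\<close> with integers \<open>b x\<close> of sum \<open>2 ^ k\<close>. Division with remainder,
  \<open>2 ^ i = N * p + q\<close>, shows that \<open>2 ^ k * p\<close> times the first relation plus \<open>q\<close> times the second
  has total weight \<open>2 ^ (k + i)\<close>. Since \<open>q < N\<close> is bounded while \<open>p\<close> grows with \<open>i\<close>, all weights of
  this combination are nonnegative for large \<open>i\<close>.
\<close>

theorem positive_dyadic_affine_combination_in_hull:
  assumes Y: "finite Y" "Y \<subseteq> dyadic_space m" and y: "y \<in> dyadic_aff Y" "y \<in> positive_combinations Y"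
  shows "y \<in> midpoint_closed hull Y"
proof -
  have "y \<in> dyadic_space m" using dyadic_aff_dyadic_space[OF Y(2)] y(1) by blast
  then obtain a :: "_ \<Rightarrow> nat" where a: "\<And>x. x \<in> Y \<Longrightarrow> a x > 0"
    "(\<Sum>x\<in>Y. real (a x) *\<^sub>R x) = real (sum a Y) *\<^sub>R y"
    using positive_combination_integral[OF Y _ y(2)] by metis
  define N where "N = sum a Y"
  have "Y \<noteq> {}" using y(2) by (auto simp: positive_combinations_def)
  then have "N > 0" using Y(1) a(1) by (auto simp: N_def intro!: sum_pos)
  obtain r where r: "\<And>x. x \<in> Y \<Longrightarrow> r x \<in> dyadic_rationals" "sum r Y = 1" "y = (\<Sum>x\<in>Y. r x *\<^sub>R x)"
    using y(1) dyadic_aff_finite[OF Y(1)] by auto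
  obtain k :: nat and b where b: "\<And>x. x \<in> Y \<Longrightarrow> 2 ^ k * r x = of_int (b x)"
    using dyadic_common_denominator[of Y r] Y(1) r(1) by metis
  have sum_b: "(\<Sum>x\<in>Y. real_of_int (b x)) = 2 ^ k"
    using r(2) by (simp flip: b sum_distrib_left)
  have b_y: "(\<Sum>x\<in>Y. real_of_int (b x) *\<^sub>R x) = 2 ^ k *\<^sub>R y"
    by (simp add: r(3) scaleR_sum_right flip: b)
  define B where "B = (\<Sum>x\<in>Y. nat \<bar>b x\<bar>)"
  \<comment> \<open>Since \<open>i < 2 ^ i\<close>, this exponent makes \<open>p \<ge> N * B\<close>, which outweighs all terms \<open>b x * q\<close>.\<close>
  define i where "i = N * (N * B)"
  define p where "p = 2 ^ i div N"
  define q where "q = 2 ^ i mod N"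
  have pq: "N * p + q = 2 ^ i" by (simp add: p_def q_def)
  have "q < N" using \<open>N > 0\<close> by (simp add: q_def)
  have "N * (N * B) \<le> 2 ^ i" unfolding i_def by (rule less_imp_le, rule less_exp)
  then have "N * B \<le> p" using \<open>N > 0\<close> by (simp add: p_def less_eq_div_iff_mult_less_eq ac_simps)
  define c where "c x = nat (int (a x * 2 ^ k * p) + b x * int q)" for x
  have c: "real (c x) = real (a x) * (2 ^ k * real p) + real_of_int (b x) * real q" if x: "x \<in> Y" for x
  proof -
    have "nat \<bar>b x\<bar> \<le> B" unfolding B_def using x Y(1) by (intro member_le_sum) auto
    then have "\<bar>b x\<bar> \<le> int B" by simp
    then have "\<bar>b x\<bar> * int q \<le> int B * int N" using \<open>q < N\<close> by (intro mult_mono) auto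
    also have "\<dots> \<le> int p" using \<open>N * B \<le> p\<close> by (metis mult.commute of_nat_le_iff of_nat_mult)
    also have "\<dots> \<le> int (a x * 2 ^ k * p)"
      unfolding of_nat_le_iff using a(1)[OF x] by simp
    finally have "- (b x * int q) \<le> int (a x * 2 ^ k * p)"
      by (metis abs_ge_minus_self abs_mult abs_of_nat order_trans)
    then have "int (c x) = int (a x * 2 ^ k * p) + b x * int q" by (simp add: c_def)
    then have "real_of_int (int (c x)) = real_of_int (int (a x * 2 ^ k * p) + b x * int q)" by simp
    then show ?thesis by simp
  qed
  have "real (sum c Y) = real N * (2 ^ k * real p) + 2 ^ k * real q"
    by (simp add: c sum.distrib N_def flip: sum_distrib_right sum_b)
  also have "\<dots> = 2 ^ k * real (N * p + q)" by (simp add: algebra_simps)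
  also have "\<dots> = 2 ^ (k + i)" by (simp add: pq power_add)
  finally have sum_c: "sum c Y = 2 ^ (k + i)"
    by (metis of_nat_eq_iff of_nat_numeral of_nat_power)
  have "(\<Sum>x\<in>Y. real (c x) *\<^sub>R x) =
      (2 ^ k * real p) *\<^sub>R (\<Sum>x\<in>Y. real (a x) *\<^sub>R x) + real q *\<^sub>R (\<Sum>x\<in>Y. real_of_int (b x) *\<^sub>R x)"
    by (simp add: c scaleR_sum_right scaleR_add_left sum.distrib mult.commute)
  also have "\<dots> = (2 ^ k * real (N * p + q)) *\<^sub>R y"
    by (simp add: a(2) b_y N_def[symmetric] algebra_simps)
  also have "\<dots> = 2 ^ (k + i) *\<^sub>R y" by (simp add: pq power_add)
  finally have "y = (1 / 2 ^ (k + i)) *\<^sub>R (\<Sum>x\<in>Y. real (c x) *\<^sub>R x)" by simp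
  also have "\<dots> \<in> midpoint_closed hull Y"
    by (rule midpoint_closed_average[OF midpoint_closed_hull hull_subset Y(1) sum_c])
  finally show ?thesis .
qed

section \<open>Submodules of dyadic spaces\<close>

text \<open>
  Closure under differences and halving amounts to being a module over the dyadic rationals; this
  form is one that the operator \<open>hull\<close> can be applied to.
\<close>

definition dyadic_submodule :: "'a::real_vector set \<Rightarrow> bool" where
  "dyadic_submodule M \<longleftrightarrow> 0 \<in> M \<and> (\<forall>a\<in>M. \<forall>b\<in>M. a - b \<in> M) \<and> (\<forall>a\<in>M. (1 / 2) *\<^sub>R a \<in> M)"

lemma dyadic_submodule_hull: "dyadic_submodule (dyadic_submodule hull X)"
  by (rule hull_in) (auto simp: dyadic_submodule_def)

lemma dyadic_submoduleD:
  assumes "dyadic_submodule M"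
  shows "0 \<in> M" "a \<in> M \<Longrightarrow> b \<in> M \<Longrightarrow> a - b \<in> M" "a \<in> M \<Longrightarrow> b \<in> M \<Longrightarrow> a + b \<in> M"
    "a \<in> M \<Longrightarrow> (1 / 2) *\<^sub>R a \<in> M"
proof -
  show *: "0 \<in> M" "a \<in> M \<Longrightarrow> b \<in> M \<Longrightarrow> a - b \<in> M" "a \<in> M \<Longrightarrow> (1 / 2) *\<^sub>R a \<in> M" for a b
    using assms by (auto simp: dyadic_submodule_def)
  show "a \<in> M \<Longrightarrow> b \<in> M \<Longrightarrow> a + b \<in> M"
    using *(2)[of a "0 - b"] *(2)[of 0 b] *(1) by simp
qed

lemma dyadic_submodule_scaleR:
  assumes M: "dyadic_submodule M" and "a \<in> M" "r \<in> dyadic_rationals"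
  shows "r *\<^sub>R a \<in> M"
proof -
  obtain z k where r: "r = of_int z / 2 ^ k" using assms(3) by (auto simp: dyadic_rationals_def)
  have nat: "real n *\<^sub>R a \<in> M" for n :: nat
    by (induction n) (use \<open>a \<in> M\<close> in \<open>auto simp: scaleR_add_left intro: dyadic_submoduleD[OF M]\<close>)
  have "of_int z *\<^sub>R a \<in> M"
  proof (cases "z \<ge> 0")
    case True
    then show ?thesis using nat[of "nat z"] by simp
  next
    case False
    then have "of_int z *\<^sub>R a = 0 - real (nat (- z)) *\<^sub>R a" by simp
    then show ?thesis using nat dyadic_submoduleD[OF M] by metis
  qed
  then have "(1 / 2 ^ k) *\<^sub>R (of_int z *\<^sub>R a) \<in> M"
  proof (induction k)
    case (Suc k)
    then show ?case using dyadic_submoduleD(4)[OF M, of "(1 / 2 ^ k) *\<^sub>R (of_int z *\<^sub>R a)"] by simp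
  qed auto
  then show ?thesis by (simp add: r)
qed

lemma dyadic_submodule_sum:
  assumes "dyadic_submodule M" "\<And>x. x \<in> A \<Longrightarrow> f x \<in> M"
  shows "sum f A \<in> M"
  using assms(2) by (induction A rule: infinite_finite_induct) (auto intro: dyadic_submoduleD[OF assms(1)])

text \<open>
  The union of the hulls of the finite subsets of \<open>T\<close> is directed, hence itself a submodule.
\<close>

lemma dyadic_submodule_hull_finitary:
  assumes "v \<in> dyadic_submodule hull T"
  obtains X where "finite X" "X \<subseteq> T" "v \<in> dyadic_submodule hull X"
proof -
  let ?F = "{v. \<exists>X. finite X \<and> X \<subseteq> T \<and> v \<in> dyadic_submodule hull X}"
  have "dyadic_submodule hull T \<subseteq> ?F"
  proof (rule hull_minimal)
    show "T \<subseteq> ?F"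
    proof
      fix x assume "x \<in> T"
      then show "x \<in> ?F" by (intro CollectI exI[of _ "{x}"]) (simp add: hull_inc)
    qed
    show "dyadic_submodule ?F"
    proof (rule dyadic_submodule_def[THEN iffD2], intro conjI ballI)
      fix a b assume a: "a \<in> ?F" and b: "b \<in> ?F"
      obtain X where X: "finite X" "X \<subseteq> T" "a \<in> dyadic_submodule hull X" using a by blast
      obtain Z where Z: "finite Z" "Z \<subseteq> T" "b \<in> dyadic_submodule hull Z" using b by blast
      have "a \<in> dyadic_submodule hull (X \<union> Z)" "b \<in> dyadic_submodule hull (X \<union> Z)"
        using X(3) Z(3) hull_mono[of X "X \<union> Z"] hull_mono[of Z "X \<union> Z"] by auto
      then show "a - b \<in> ?F"
        using X Z dyadic_submoduleD(2)[OF dyadic_submodule_hull] by (intro CollectI exI[of _ "X \<union> Z"]) auto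
    next
      show "0 \<in> ?F"
        using dyadic_submoduleD(1)[OF dyadic_submodule_hull] by (intro CollectI exI[of _ "{}"]) auto
    next
      fix a assume "a \<in> ?F"
      then obtain X where "finite X" "X \<subseteq> T" "a \<in> dyadic_submodule hull X" by blast
      then show "(1 / 2) *\<^sub>R a \<in> ?F"
        using dyadic_submoduleD(4)[OF dyadic_submodule_hull] by (intro CollectI exI[of _ X]) auto
    qed
  qed
  then show ?thesis using assms that by auto
qed

lemma dyadic_submodule_dyadic_space: "dyadic_submodule (dyadic_space m)"
  by (auto simp: dyadic_submodule_def dyadic_space_iff intro: dyadic_diff dyadic_half)

text \<open>
  The dyadic rationals form a principal ideal domain: every element of an ideal is, up to a unit
  \<open>\<plusminus>2 ^ k\<close>, a natural number, and the least positive natural number in the ideal generates it.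
\<close>

lemma dyadic_ideal_principal:
  assumes I: "dyadic_submodule I" "I \<subseteq> dyadic_rationals"
  obtains g where "g \<in> I" "\<And>x. x \<in> I \<Longrightarrow> \<exists>d\<in>dyadic_rationals. x = d * g"
proof (cases "I \<subseteq> {0}")
  case True
  then have "\<exists>d\<in>dyadic_rationals. x = d * 0" if "x \<in> I" for x
    using that by (intro bexI[of _ 0]) auto
  then show ?thesis using that[of 0] dyadic_submoduleD(1)[OF I(1)] by simp
next
  case False
  have positive_integer: "\<exists>n k. n > 0 \<and> real n \<in> I \<and> \<bar>x\<bar> * 2 ^ k = real n" if x: "x \<in> I" "x \<noteq> 0" for x
  proof -
    obtain a k where a: "x = of_int a / 2 ^ k" using x I(2) by (auto simp: dyadic_rationals_def)
    have "sgn (real_of_int a) * 2 ^ k \<in> dyadic_rationals"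
      using dyadic_of_int[of "sgn a * 2 ^ k"] by (simp add: sgn_if split: if_splits)
    then have "(sgn (real_of_int a) * 2 ^ k) *\<^sub>R x \<in> I" using dyadic_submodule_scaleR[OF I(1)] x(1) by blast
    moreover have "(sgn (real_of_int a) * 2 ^ k) *\<^sub>R x = real (nat \<bar>a\<bar>)"
      by (simp add: a sgn_if)
    ultimately show ?thesis using x(2) a by (intro exI[of _ "nat \<bar>a\<bar>"] exI[of _ k]) auto
  qed
  define g where "g = (LEAST n::nat. n > 0 \<and> real n \<in> I)"
  obtain x where "x \<in> I" "x \<noteq> 0" using False by auto
  then have "\<exists>n::nat. n > 0 \<and> real n \<in> I" using positive_integer by blast
  then have g: "g > 0" "real g \<in> I" unfolding g_def by (rule LeastI2_ex, blast)+
  have g_least: "n = 0" if "real n \<in> I" "n < g" for n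
    using not_less_Least[of n "\<lambda>n. n > 0 \<and> real n \<in> I"] that by (auto simp: g_def)
  show ?thesis
  proof (rule that[OF g(2)])
    fix x assume x: "x \<in> I"
    show "\<exists>d\<in>dyadic_rationals. x = d * real g"
    proof (cases "x = 0")
      case False
      then obtain n k where n: "real n \<in> I" "\<bar>x\<bar> * 2 ^ k = real n" using positive_integer x by blast
      have "real n - real (n div g) *\<^sub>R real g \<in> I"
        using dyadic_submodule_scaleR[OF I(1) g(2), of "real (n div g)"] dyadic_of_int[of "int (n div g)"] n(1)
        by (auto intro: dyadic_submoduleD[OF I(1)])
      moreover have "real n - real (n div g) *\<^sub>R real g = real (n mod g)"
        by (metis add_diff_cancel_left' mult_div_mod_eq of_nat_add of_nat_mult real_scaleR_def mult.commute)
      ultimately have "n mod g = 0" using g_least g(1) by simp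
      then have "n = n div g * g" by auto
      then have "\<bar>x\<bar> * 2 ^ k = real (n div g) * real g" using n(2) by (metis of_nat_mult)
      then have "x = (of_int (if x < 0 then - int (n div g) else int (n div g)) / 2 ^ k) * real g"
        by (auto simp: field_simps split: if_splits)
      then show ?thesis using dyadic_of_int_div by blast
    qed (auto intro!: bexI[of _ 0])
  qed
qed

text \<open>
  Submodules of free modules over a principal ideal domain are free. The induction removes the last
  coordinate: its values on \<open>M\<close> form a principal ideal; an element \<open>c\<close> of \<open>M\<close> whose last coordinate
  generates this ideal is added to a basis of the submodule \<open>M'\<close> where this coordinate vanishes.
\<close>

theorem dyadic_submodule_free:
  assumes "dyadic_submodule M" "M \<subseteq> dyadic_space n"
  obtains m and b :: "nat \<Rightarrow> nat \<Rightarrow> real"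
  where "bij_betw (\<lambda>y. \<Sum>i<m. y i *\<^sub>R b i) (dyadic_space m) M"
proof -
  have "\<exists>m b. bij_betw (\<lambda>y. \<Sum>i<m. y i *\<^sub>R b i) (dyadic_space m) M"
    using assms
  proof (induction n arbitrary: M)
    case 0
    have zero: "dyadic_space 0 = {0}" by (auto simp: dyadic_space_iff)
    then have "M = {0}" using 0 dyadic_submoduleD(1)[OF 0(1)] by auto
    then show ?case by (intro exI[of _ 0] exI) (auto simp: zero bij_betw_def)
  next
    case (Suc n)
    note M = Suc.prems(1)
    have "dyadic_submodule ((\<lambda>x. x n) ` M)"
      unfolding dyadic_submodule_def
    proof (intro conjI ballI)
      show "0 \<in> (\<lambda>x. x n) ` M"
        using dyadic_submoduleD(1)[OF M] by (intro image_eqI[of _ _ 0]) auto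
      show "u - v \<in> (\<lambda>x. x n) ` M" if uv: "u \<in> (\<lambda>x. x n) ` M" "v \<in> (\<lambda>x. x n) ` M" for u v
      proof -
        obtain x z where "x \<in> M" "z \<in> M" "u = x n" "v = z n" using uv by blast
        then show ?thesis
          using dyadic_submoduleD(2)[OF M] by (intro image_eqI[of _ _ "x - z"]) auto
      qed
      show "(1 / 2) *\<^sub>R u \<in> (\<lambda>x. x n) ` M" if u: "u \<in> (\<lambda>x. x n) ` M" for u
      proof -
        obtain x where "x \<in> M" "u = x n" using u by blast
        then show ?thesis
          using dyadic_submoduleD(4)[OF M] by (intro image_eqI[of _ _ "(1 / 2) *\<^sub>R x"]) auto
      qed
    qed
    moreover have "(\<lambda>x. x n) ` M \<subseteq> dyadic_rationals"
      using Suc.prems(2) by (auto simp: dyadic_space_iff)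
    ultimately obtain c where c: "c \<in> M"
      "\<And>x. x \<in> M \<Longrightarrow> \<exists>d\<in>dyadic_rationals. x n = d * c n"
      by (elim dyadic_ideal_principal) auto
    define M' where "M' = {x \<in> M. x n = 0}"
    have "dyadic_submodule M'"
      using dyadic_submoduleD[OF M] by (auto simp: dyadic_submodule_def M'_def)
    moreover have "M' \<subseteq> dyadic_space n"
    proof
      fix x assume x: "x \<in> M'"
      have "x i = 0" if "n \<le> i" for i
        using x Suc.prems(2) that by (cases "i = n") (auto simp: M'_def dyadic_space_iff)
      then show "x \<in> dyadic_space n" using x Suc.prems(2) by (auto simp: M'_def dyadic_space_iff)
    qed
    ultimately obtain m b where "bij_betw (\<lambda>y. \<Sum>i<m. y i *\<^sub>R b i) (dyadic_space m) M'"
      using Suc.IH by blast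
    then have inj: "inj_on (\<lambda>y. \<Sum>i<m. y i *\<^sub>R b i) (dyadic_space m)"
      and M': "M' = (\<lambda>y. \<Sum>i<m. y i *\<^sub>R b i) ` dyadic_space m" by (auto simp: bij_betw_def)
    show ?case
    proof (cases "c n = 0")
      case True
      then have "M' = M" using c(2) by (auto simp: M'_def)
      then show ?thesis using \<open>bij_betw _ _ M'\<close> by blast
    next
      case False
      define b' where "b' = b(m := c)"
      have sum_Suc: "(\<Sum>i<Suc m. y i *\<^sub>R b' i) = (\<Sum>i<m. y i *\<^sub>R b i) + y m *\<^sub>R c" for y :: "nat \<Rightarrow> real"
        by (simp add: b'_def)
      have restrict: "y(m := 0) \<in> dyadic_space m" if "y \<in> dyadic_space (Suc m)" for y
        using that by (auto simp: dyadic_space_iff)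
      have sum_restrict: "(\<Sum>i<m. (y(m := t)) i *\<^sub>R b i) = (\<Sum>i<m. y i *\<^sub>R b i)" for y and t :: real
        by (intro sum.cong) auto
      have in_M': "(\<Sum>i<m. y i *\<^sub>R b i) \<in> M'" if "y \<in> dyadic_space (Suc m)" for y
        unfolding M' by (rule image_eqI[OF _ restrict[OF that]]) (rule sum_restrict[symmetric])
      have "bij_betw (\<lambda>y. \<Sum>i<Suc m. y i *\<^sub>R b' i) (dyadic_space (Suc m)) M"
        unfolding bij_betw_def
      proof
        show "inj_on (\<lambda>y. \<Sum>i<Suc m. y i *\<^sub>R b' i) (dyadic_space (Suc m))"
        proof (rule inj_onI)
          fix y z assume y: "y \<in> dyadic_space (Suc m)" and z: "z \<in> dyadic_space (Suc m)"
            and eq: "(\<Sum>i<Suc m. y i *\<^sub>R b' i) = (\<Sum>i<Suc m. z i *\<^sub>R b' i)"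
          have "(\<Sum>i<Suc m. u i *\<^sub>R b' i) n = u m * c n" if "u \<in> dyadic_space (Suc m)" for u
            using in_M'[OF that] unfolding sum_Suc by (simp add: M'_def)
          then have "y m = z m" using eq y z False by (metis mult_right_cancel)
          then have "(\<Sum>i<m. (y(m := 0)) i *\<^sub>R b i) = (\<Sum>i<m. (z(m := 0)) i *\<^sub>R b i)"
            using eq unfolding sum_Suc sum_restrict by simp
          then have "y(m := 0) = z(m := 0)" using inj_onD[OF inj _ restrict[OF y] restrict[OF z]] by simp
          then show "y = z" using \<open>y m = z m\<close> by (metis fun_upd_triv fun_upd_upd)
        qed
        show "(\<lambda>y. \<Sum>i<Suc m. y i *\<^sub>R b' i) ` dyadic_space (Suc m) = M"
        proof (intro equalityI subsetI)
          fix x assume "x \<in> (\<lambda>y. \<Sum>i<Suc m. y i *\<^sub>R b' i) ` dyadic_space (Suc m)"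
          then obtain y where y: "y \<in> dyadic_space (Suc m)" "x = (\<Sum>i<m. y i *\<^sub>R b i) + y m *\<^sub>R c"
            using sum_Suc by auto
          then show "x \<in> M"
            using in_M'[OF y(1)] dyadic_submodule_scaleR[OF M c(1), of "y m"]
            by (auto simp: M'_def dyadic_space_iff intro!: dyadic_submoduleD(3)[OF M])
        next
          fix x assume x: "x \<in> M"
          then obtain d where d: "d \<in> dyadic_rationals" "x n = d * c n" using c(2) by blast
          then have "x - d *\<^sub>R c \<in> M'"
            using x dyadic_submodule_scaleR[OF M c(1)] dyadic_submoduleD(2)[OF M] by (simp add: M'_def)
          then obtain y where y: "y \<in> dyadic_space m" "x - d *\<^sub>R c = (\<Sum>i<m. y i *\<^sub>R b i)" using M' by auto
          have "x = (\<Sum>i<Suc m. (y(m := d)) i *\<^sub>R b' i)"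
            unfolding sum_Suc sum_restrict by (simp flip: y(2))
          moreover have "y(m := d) \<in> dyadic_space (Suc m)" using y(1) d(1) by (auto simp: dyadic_space_iff)
          ultimately show "x \<in> (\<lambda>y. \<Sum>i<Suc m. y i *\<^sub>R b' i) ` dyadic_space (Suc m)" by blast
        qed
      qed
      then show ?thesis by blast
    qed
  qed
  then show ?thesis using that by blast
qed

text \<open>
  Choosing \<open>y0\<close> as the origin turns affine combinations into linear ones, because the coefficient
  of \<open>y0\<close> can be adjusted to make the sum of the coefficients one.
\<close>

lemma dyadic_aff_via_submodule:
  assumes Y: "finite Y" "y0 \<in> Y" and y: "y - y0 \<in> dyadic_submodule hull ((\<lambda>x. x - y0) ` Y)"
  shows "y \<in> dyadic_aff Y"
proof -
  let ?M = "{\<Sum>x\<in>Y. r x *\<^sub>R (x - y0) | r. \<forall>x\<in>Y. r x \<in> dyadic_rationals}"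
  have "dyadic_submodule hull ((\<lambda>x. x - y0) ` Y) \<subseteq> ?M"
  proof (rule hull_minimal)
    show "(\<lambda>x. x - y0) ` Y \<subseteq> ?M"
    proof (clarify, intro exI conjI)
      fix z assume "z \<in> Y"
      then show "z - y0 = (\<Sum>x\<in>Y. (if x = z then 1 else 0) *\<^sub>R (x - y0))"
        using Y(1) by (simp add: if_distrib[of "\<lambda>r. r *\<^sub>R _"] cong: if_cong)
    qed auto
    have "a - b \<in> ?M" if ab: "a \<in> ?M" "b \<in> ?M" for a b
    proof -
      obtain r s where "\<forall>x\<in>Y. r x \<in> dyadic_rationals" "a = (\<Sum>x\<in>Y. r x *\<^sub>R (x - y0))"
        "\<forall>x\<in>Y. s x \<in> dyadic_rationals" "b = (\<Sum>x\<in>Y. s x *\<^sub>R (x - y0))" using ab by blast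
      then show ?thesis
        by (intro CollectI exI[of _ "\<lambda>x. r x - s x"]) (auto simp: scaleR_diff_left sum_subtractf intro: dyadic_diff)
    qed
    moreover have "0 \<in> ?M" by (intro CollectI exI[of _ "\<lambda>_. 0"]) auto
    moreover have "(1 / 2) *\<^sub>R a \<in> ?M" if a: "a \<in> ?M" for a
    proof -
      obtain r where "\<forall>x\<in>Y. r x \<in> dyadic_rationals" "a = (\<Sum>x\<in>Y. r x *\<^sub>R (x - y0))" using a by blast
      then show ?thesis
        by (intro CollectI exI[of _ "\<lambda>x. r x / 2"]) (auto simp: scaleR_sum_right intro: dyadic_half)
    qed
    ultimately show "dyadic_submodule ?M" unfolding dyadic_submodule_def by blast
  qed
  then obtain r where r: "\<forall>x\<in>Y. r x \<in> dyadic_rationals" "y - y0 = (\<Sum>x\<in>Y. r x *\<^sub>R (x - y0))"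
    using y by blast
  define s where "s x = r x + (if x = y0 then 1 - sum r Y else 0)" for x
  have "sum s Y = 1" using Y by (simp add: s_def sum.distrib)
  moreover have "(\<Sum>x\<in>Y. s x *\<^sub>R x) = y"
  proof -
    have "(\<Sum>x\<in>Y. s x *\<^sub>R x) = (\<Sum>x\<in>Y. r x *\<^sub>R x) + (1 - sum r Y) *\<^sub>R y0"
      using Y by (simp add: s_def sum.distrib scaleR_add_left if_distrib[of "\<lambda>r. r *\<^sub>R _"] cong: if_cong)
    also have "\<dots> = (\<Sum>x\<in>Y. r x *\<^sub>R (x - y0)) + y0"
      by (simp add: scaleR_diff_right sum_subtractf scaleR_diff_left flip: scaleR_sum_left)
    finally show ?thesis by (simp flip: r(2))
  qed
  moreover have "\<forall>x\<in>Y. s x \<in> dyadic_rationals"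
    using r(1) by (auto simp: s_def intro!: dyadic_add dyadic_diff dyadic_sum)
  ultimately show ?thesis using dyadic_aff_finite[OF Y(1)] by metis
qed

text \<open>
  This is the Noetherian property of dyadic spaces in affine form. Relative to an origin in \<open>T\<close>, the
  points of \<open>T\<close> span a free module of finite rank, and each of its finitely many basis elements
  involves only finitely many points of \<open>T\<close>.
\<close>

theorem finite_subset_dyadic_aff:
  assumes "T \<subseteq> dyadic_space n"
  obtains X where "finite X" "X \<subseteq> T" "T \<subseteq> dyadic_aff X"
proof (cases "T = {}")
  case True
  then show ?thesis using that[of "{}"] by simp
next
  case False
  then obtain t0 where t0: "t0 \<in> T" by blast
  define M where "M = dyadic_submodule hull ((\<lambda>t. t - t0) ` T)"
  have "M \<subseteq> dyadic_space n"
    unfolding M_def using assms t0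
    by (intro hull_minimal dyadic_submodule_dyadic_space)
      (auto intro!: dyadic_submoduleD(2)[OF dyadic_submodule_dyadic_space])
  then obtain m and b :: "nat \<Rightarrow> nat \<Rightarrow> real"
    where b: "bij_betw (\<lambda>y. \<Sum>i<m. y i *\<^sub>R b i) (dyadic_space m) M"
    using dyadic_submodule_free[of M n] dyadic_submodule_hull M_def by metis
  have "b i \<in> M" if "i < m" for i
  proof -
    have "(\<lambda>j. if j = i then 1 else 0) \<in> dyadic_space m" using that by (auto simp: dyadic_space_iff)
    then have "(\<Sum>j<m. (if j = i then 1 else 0) *\<^sub>R b j) \<in> M"
      using b by (force simp: bij_betw_def)
    then show ?thesis using that by (simp add: if_distrib[of "\<lambda>r. r *\<^sub>R _"] cong: if_cong)
  qed
  then have "\<exists>Z. finite Z \<and> Z \<subseteq> (\<lambda>t. t - t0) ` T \<and> b i \<in> dyadic_submodule hull Z" if "i < m" for i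
    using that dyadic_submodule_hull_finitary[of "b i"] by (metis M_def)
  then obtain Z where Z: "\<And>i. i < m \<Longrightarrow> finite (Z i) \<and> Z i \<subseteq> (\<lambda>t. t - t0) ` T \<and> b i \<in> dyadic_submodule hull Z i"
    by metis
  define X where "X = insert t0 ((\<lambda>z. z + t0) ` (\<Union>i<m. Z i))"
  have X: "finite X" using Z by (auto simp: X_def)
  have "z + t0 \<in> T" if i: "i < m" and z: "z \<in> Z i" for i z
  proof -
    obtain t where "t \<in> T" "z = t - t0" using Z[OF i] z by blast
    then show ?thesis by simp
  qed
  then have "X \<subseteq> T" using t0 by (auto simp: X_def)
  have Z_X: "(\<Union>i<m. Z i) \<subseteq> (\<lambda>x. x - t0) ` X" by (force simp: X_def image_iff)
  show ?thesis
  proof (rule that[OF X \<open>X \<subseteq> T\<close>], rule subsetI, rule dyadic_aff_via_submodule[OF X, of t0])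
    fix t assume t: "t \<in> T"
    then have "t - t0 \<in> M" by (auto simp: M_def intro!: hull_inc)
    then obtain y where y: "y \<in> dyadic_space m" "t - t0 = (\<Sum>i<m. y i *\<^sub>R b i)" using b by (auto simp: bij_betw_def)
    have "b i \<in> dyadic_submodule hull ((\<lambda>x. x - t0) ` X)" if "i < m" for i
      using Z[OF that] hull_mono[of "Z i" "(\<lambda>x. x - t0) ` X"] Z_X that by blast
    then show "t - t0 \<in> dyadic_submodule hull ((\<lambda>x. x - t0) ` X)"
      using y(1) unfolding y(2)
      by (intro dyadic_submodule_sum dyadic_submodule_scaleR dyadic_submodule_hull) (auto simp: dyadic_space_iff)
  qed (simp add: X_def)
qed

section \<open>Positive combinations and relative interiors\<close>

lemma positive_combinations_subset_convex_hull:
  assumes "finite W"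
  shows "positive_combinations W \<subseteq> convex hull W"
proof
  fix s assume "s \<in> positive_combinations W"
  then obtain t where "\<forall>w\<in>W. 0 < t w" "sum t W = 1" "s = (\<Sum>w\<in>W. t w *\<^sub>R w)"
    by (auto simp: positive_combinations_def)
  then show "s \<in> convex hull W"
    unfolding convex_hull_finite[OF assms] by (intro CollectI exI[of _ t]) (auto intro: less_imp_le)
qed

lemma barycenter_positive:
  assumes "finite X" "X \<noteq> {}"
  shows "(\<Sum>x\<in>X. (1 / real (card X)) *\<^sub>R x) \<in> positive_combinations X"
  using assms unfolding positive_combinations_def
  by (intro CollectI exI[of _ "\<lambda>_. 1 / real (card X)"]) (auto simp: card_gt_0_iff)

text \<open>
  The ray from \<open>c\<close> through a relatively interior point \<open>s\<close> stays in the convex hull for a while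
  after \<open>s\<close>. Half the least weight of \<open>s\<close> is an admissible \<open>\<epsilon>\<close>: it is less than one, and since
  the weights of \<open>c\<close> are at most one, \<open>s - \<epsilon> *\<^sub>R c\<close> keeps nonnegative weights.
\<close>

lemma positive_combination_extend:
  assumes W: "finite W" "s \<in> positive_combinations W" "c \<in> convex hull W"
  obtains \<epsilon> z where "0 < \<epsilon>" "\<epsilon> < 1" "z \<in> convex hull W" "s = (1 - \<epsilon>) *\<^sub>R z + \<epsilon> *\<^sub>R c"
proof -
  obtain t where t: "\<And>w. w \<in> W \<Longrightarrow> 0 < t w" "sum t W = 1" "s = (\<Sum>w\<in>W. t w *\<^sub>R w)"
    using W(2) by (auto simp: positive_combinations_def)
  obtain u where u: "\<And>w. w \<in> W \<Longrightarrow> 0 \<le> u w" "sum u W = 1" "c = (\<Sum>w\<in>W. u w *\<^sub>R w)"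
    using W(3) by (auto simp: convex_hull_finite[OF W(1)])
  have "W \<noteq> {}" using t(2) by auto
  define \<epsilon> where "\<epsilon> = Min (t ` W) / 2"
  have "0 < Min (t ` W)" using W(1) \<open>W \<noteq> {}\<close> t(1) by simp
  then have "\<epsilon> > 0" by (simp add: \<epsilon>_def)
  have Min_t: "Min (t ` W) \<le> t w" if "w \<in> W" for w using that W(1) by simp
  have t_le: "\<epsilon> \<le> t w" if "w \<in> W" for w
    using Min_t[OF that] \<open>0 < Min (t ` W)\<close> unfolding \<epsilon>_def by linarith
  obtain w0 where w0: "w0 \<in> W" using \<open>W \<noteq> {}\<close> by blast
  have "t w0 \<le> 1" using member_le_sum[OF w0, of t] W(1) t(1,2) by (auto simp: less_imp_le)
  then have "\<epsilon> < 1" using Min_t[OF w0] unfolding \<epsilon>_def by linarith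
  have u_le: "u w \<le> 1" if "w \<in> W" for w using member_le_sum[OF that, of u] W(1) u(1,2) by auto
  define p where "p w = (t w - \<epsilon> * u w) / (1 - \<epsilon>)" for w
  have p: "(1 - \<epsilon>) * p w = t w - \<epsilon> * u w" for w using \<open>\<epsilon> < 1\<close> by (simp add: p_def)
  have "0 \<le> p w" if w: "w \<in> W" for w
  proof -
    have "\<epsilon> * u w \<le> \<epsilon>" using u_le[OF w] \<open>\<epsilon> > 0\<close> by (simp add: mult_left_le)
    then show ?thesis using t_le[OF w] \<open>\<epsilon> < 1\<close> by (simp add: p_def)
  qed
  moreover have "sum p W = 1"
    using t(2) u(2) \<open>\<epsilon> < 1\<close> by (simp add: p_def sum_subtractf flip: sum_divide_distrib sum_distrib_left)
  ultimately have "(\<Sum>w\<in>W. p w *\<^sub>R w) \<in> convex hull W"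
    by (auto simp: convex_hull_finite[OF W(1)])
  moreover have "s = (1 - \<epsilon>) *\<^sub>R (\<Sum>w\<in>W. p w *\<^sub>R w) + \<epsilon> *\<^sub>R c"
    by (simp add: t(3) u(3) scaleR_sum_right p scaleR_diff_left sum_subtractf)
  ultimately show ?thesis using that \<open>\<epsilon> > 0\<close> \<open>\<epsilon> < 1\<close> by blast
qed

lemma convex_combination_positive:
  assumes X: "finite X" "z \<in> convex hull X" "c \<in> positive_combinations X" and "0 < \<epsilon>" "\<epsilon> \<le> 1"
  shows "(1 - \<epsilon>) *\<^sub>R z + \<epsilon> *\<^sub>R c \<in> positive_combinations X"
proof -
  obtain t where t: "\<And>w. w \<in> X \<Longrightarrow> 0 < t w" "sum t X = 1" "c = (\<Sum>w\<in>X. t w *\<^sub>R w)"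
    using X(3) by (auto simp: positive_combinations_def)
  obtain u where u: "\<And>w. w \<in> X \<Longrightarrow> 0 \<le> u w" "sum u X = 1" "z = (\<Sum>w\<in>X. u w *\<^sub>R w)"
    using X(2) by (auto simp: convex_hull_finite[OF X(1)])
  show ?thesis
    unfolding positive_combinations_def
  proof (intro CollectI exI conjI ballI)
    show "(1 - \<epsilon>) *\<^sub>R z + \<epsilon> *\<^sub>R c = (\<Sum>w\<in>X. ((1 - \<epsilon>) * u w + \<epsilon> * t w) *\<^sub>R w)"
      by (simp add: t(3) u(3) scaleR_sum_right scaleR_add_left sum.distrib)
    show "0 < (1 - \<epsilon>) * u w + \<epsilon> * t w" if "w \<in> X" for w
      using u(1)[OF that] t(1)[OF that] assms(4,5) by (intro add_nonneg_pos) auto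
    show "(\<Sum>w\<in>X. (1 - \<epsilon>) * u w + \<epsilon> * t w) = 1"
      by (simp add: sum.distrib t(2) u(2) flip: sum_distrib_left)
  qed
qed

text \<open>
  Adding points of the convex hull to the generators does not shrink the relative interior: prolong
  the segment from the barycenter \<open>c\<close> of \<open>X\<close> through \<open>s\<close> to a point \<open>z\<close> of the hull; then \<open>s\<close>
  inherits positive weights from \<open>c\<close>.
\<close>

lemma positive_combinations_superset:
  assumes "finite X" "W \<subseteq> X" "X \<subseteq> convex hull W"
  shows "positive_combinations W \<subseteq> positive_combinations X"
proof
  fix s assume s: "s \<in> positive_combinations W"
  have "finite W" using assms(1,2) finite_subset by blast
  have "W \<noteq> {}" using s by (auto simp: positive_combinations_def)
  define c where "c = (\<Sum>x\<in>X. (1 / real (card X)) *\<^sub>R x)"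
  have c: "c \<in> positive_combinations X"
    unfolding c_def using assms \<open>W \<noteq> {}\<close> by (intro barycenter_positive) auto
  then have "c \<in> convex hull X" using positive_combinations_subset_convex_hull[OF assms(1)] by blast
  then have "c \<in> convex hull W" using hull_minimal[OF assms(3), of convex] by auto
  then obtain \<epsilon> z where "0 < \<epsilon>" "\<epsilon> < 1" "z \<in> convex hull W" "s = (1 - \<epsilon>) *\<^sub>R z + \<epsilon> *\<^sub>R c"
    using positive_combination_extend[OF \<open>finite W\<close> s] by metis
  then show "s \<in> positive_combinations X"
    using convex_combination_positive[OF assms(1) _ c] hull_mono[OF assms(2), of convex]
    by (simp add: subset_iff)
qed

text \<open>
  As in \<open>positive_combinations_superset\<close>, the segment from the barycenter of \<open>Y\<close> through \<open>y\<close> can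
  be prolonged inside the hull, now because \<open>y\<close> has a neighbourhood in the affine hull that
  is contained in the convex hull.
\<close>

lemma rel_interior_positive_combinations:
  fixes Y :: "(nat \<Rightarrow> real) set"
  assumes "finite Y" "y \<in> rel_interior (convex hull Y)"
  shows "y \<in> positive_combinations Y"
proof -
  obtain T where T: "open T" "y \<in> T" "y \<in> convex hull Y" "T \<inter> affine hull (convex hull Y) \<subseteq> convex hull Y"
    using assms(2) mem_rel_interior by blast
  then have "Y \<noteq> {}" by auto
  define c where "c = (\<Sum>x\<in>Y. (1 / real (card Y)) *\<^sub>R x)"
  have c: "c \<in> positive_combinations Y"
    unfolding c_def using assms \<open>Y \<noteq> {}\<close> by (intro barycenter_positive) auto
  then have c_hull: "c \<in> convex hull Y" using positive_combinations_subset_convex_hull[OF assms(1)] by blast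
  define f where "f \<epsilon> = y + \<epsilon> *\<^sub>R (y - c)" for \<epsilon> :: real
  have "continuous_on UNIV f"
    unfolding f_def by (intro continuous_on_coordinatewise_then_product) (auto intro!: continuous_intros)
  then have "open (f -` T)" using T(1) by (simp add: open_vimage)
  moreover have "0 \<in> f -` T" using T(2) by (simp add: f_def)
  ultimately obtain \<epsilon> where \<epsilon>: "\<epsilon> > 0" "cball 0 \<epsilon> \<subseteq> f -` T" by (meson open_contains_cball)
  moreover have "\<epsilon> \<in> cball 0 \<epsilon>" using \<epsilon>(1) by simp
  ultimately have "f \<epsilon> \<in> T" by blast
  moreover have "f \<epsilon> = (1 + \<epsilon>) *\<^sub>R y + (- \<epsilon>) *\<^sub>R c" by (simp add: f_def algebra_simps)
  then have "f \<epsilon> \<in> affine hull (convex hull Y)"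
    using mem_affine[OF affine_affine_hull hull_inc[OF T(3)] hull_inc[OF c_hull], of "1 + \<epsilon>" "- \<epsilon>"]
    by simp
  ultimately have "f \<epsilon> \<in> convex hull Y" using T(4) by blast
  then have "(1 - \<epsilon> / (1 + \<epsilon>)) *\<^sub>R f \<epsilon> + (\<epsilon> / (1 + \<epsilon>)) *\<^sub>R c \<in> positive_combinations Y"
    using \<epsilon>(1) by (intro convex_combination_positive assms(1) c) auto
  also have "(1 - \<epsilon> / (1 + \<epsilon>)) *\<^sub>R f \<epsilon> + (\<epsilon> / (1 + \<epsilon>)) *\<^sub>R c = y"
  proof -
    have "1 - \<epsilon> / (1 + \<epsilon>) = 1 / (1 + \<epsilon>)" using \<epsilon>(1) by (simp add: field_simps)
    then have "(1 - \<epsilon> / (1 + \<epsilon>)) *\<^sub>R f \<epsilon> + (\<epsilon> / (1 + \<epsilon>)) *\<^sub>R c = (1 / (1 + \<epsilon>)) *\<^sub>R (f \<epsilon> + \<epsilon> *\<^sub>R c)"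
      by (simp add: scaleR_add_right)
    also have "f \<epsilon> + \<epsilon> *\<^sub>R c = (1 + \<epsilon>) *\<^sub>R y" by (simp add: f_def algebra_simps)
    also have "(1 / (1 + \<epsilon>)) *\<^sub>R ((1 + \<epsilon>) *\<^sub>R y) = y" using \<epsilon>(1) by simp
    finally show ?thesis .
  qed
  finally show ?thesis .
qed

section \<open>Extreme points of finitely generated convex sets\<close>

text \<open>
  A non-extreme point of a polytope is a convex combination of the generators in a nontrivial way,
  even if it is a generator itself. Mixing the weights of the two endpoints of the segment gives such
  a combination: were all of its weight on \<open>v\<close>, both endpoints would be \<open>v\<close>.
\<close>

lemma open_segment_convex_hull_weights:
  assumes "finite Y" "a \<in> convex hull Y" "b \<in> convex hull Y" "v \<in> open_segment a b"
  obtains t where "\<And>y. y \<in> Y \<Longrightarrow> 0 \<le> t y" "sum t Y = 1" "v = (\<Sum>y\<in>Y. t y *\<^sub>R y)"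
    "\<exists>y\<in>Y. y \<noteq> v \<and> 0 < t y"
proof -
  obtain \<alpha> where \<alpha>: "\<And>w. w \<in> Y \<Longrightarrow> 0 \<le> \<alpha> w" "sum \<alpha> Y = 1" "a = (\<Sum>w\<in>Y. \<alpha> w *\<^sub>R w)"
    using assms(2) by (auto simp: convex_hull_finite[OF assms(1)])
  obtain \<beta> where \<beta>: "\<And>w. w \<in> Y \<Longrightarrow> 0 \<le> \<beta> w" "sum \<beta> Y = 1" "b = (\<Sum>w\<in>Y. \<beta> w *\<^sub>R w)"
    using assms(3) by (auto simp: convex_hull_finite[OF assms(1)])
  obtain u where u: "a \<noteq> b" "0 < u" "u < 1" "v = (1 - u) *\<^sub>R a + u *\<^sub>R b"
    using assms(4) by (auto simp: in_segment)
  define t where "t y = (1 - u) * \<alpha> y + u * \<beta> y" for y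
  have nonneg: "0 \<le> t y" if "y \<in> Y" for y using \<alpha>(1)[OF that] \<beta>(1)[OF that] u by (simp add: t_def)
  have "sum t Y = 1" by (simp add: t_def sum.distrib \<alpha>(2) \<beta>(2) flip: sum_distrib_left)
  moreover have "v = (\<Sum>y\<in>Y. t y *\<^sub>R y)"
    by (simp add: u(4) \<alpha>(3) \<beta>(3) t_def scaleR_sum_right scaleR_add_left sum.distrib)
  moreover have "\<exists>y\<in>Y. y \<noteq> v \<and> 0 < t y"
  proof (rule ccontr)
    assume "\<not> ?thesis"
    then have "t y = 0" if "y \<in> Y" "y \<noteq> v" for y using nonneg that by force
    then have "(1 - u) * \<alpha> y + u * \<beta> y = 0" if "y \<in> Y" "y \<noteq> v" for y
      using that unfolding t_def by blast
    moreover have "0 \<le> (1 - u) * \<alpha> y" "0 \<le> u * \<beta> y" if "y \<in> Y" for y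
      using \<alpha>(1)[OF that] \<beta>(1)[OF that] u(2,3) by simp_all
    ultimately have zero: "\<alpha> y = 0 \<and> \<beta> y = 0" if "y \<in> Y" "y \<noteq> v" for y
      using that u(2,3) by (metis add_nonneg_eq_0_iff diff_gt_0_iff_gt mult_eq_0_iff order_less_irrefl)
    have "a = (\<Sum>w\<in>Y. \<alpha> w *\<^sub>R v)" unfolding \<alpha>(3) using zero by (intro sum.cong) auto
    moreover have "b = (\<Sum>w\<in>Y. \<beta> w *\<^sub>R v)" unfolding \<beta>(3) using zero by (intro sum.cong) auto
    ultimately show False using u(1) \<alpha>(2) \<beta>(2) by (simp flip: scaleR_sum_left)
  qed
  ultimately show ?thesis using that nonneg by blast
qed

text \<open>
  This is the elementary case of the Krein-Milman theorem, valid without any topology: a generator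
  that is not extreme is a convex combination of the other generators and can be dropped.
\<close>

lemma convex_hull_extreme_points:
  assumes "finite X"
  shows "convex hull X = convex hull {v. v extreme_point_of (convex hull X)}"
  using assms
proof (induction X rule: finite_psubset_induct)
  case (psubset X)
  show ?case
  proof (cases "\<forall>x\<in>X. x extreme_point_of (convex hull X)")
    case True
    then have "{v. v extreme_point_of (convex hull X)} = X"
      using extreme_point_of_convex_hull by blast
    then show ?thesis by simp
  next
    case False
    then obtain x where x: "x \<in> X" "\<not> x extreme_point_of (convex hull X)" by blast
    then obtain a b where ab: "a \<in> convex hull X" "b \<in> convex hull X" "x \<in> open_segment a b"
      using hull_inc[of x X convex] by (auto simp: extreme_point_of_def)
    obtain t where t: "\<And>y. y \<in> X \<Longrightarrow> 0 \<le> t y" "sum t X = 1" "x = (\<Sum>y\<in>X. t y *\<^sub>R y)"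
      "\<exists>y\<in>X. y \<noteq> x \<and> 0 < t y"
      by (rule open_segment_convex_hull_weights[OF psubset.hyps ab]) (rule that)
    have "t x + sum t (X - {x}) = 1"
      using sum.remove[OF psubset.hyps x(1), of t] t(2) by simp
    moreover have "t x *\<^sub>R x + (\<Sum>y\<in>X - {x}. t y *\<^sub>R y) = x"
      using sum.remove[OF psubset.hyps x(1), of "\<lambda>y. t y *\<^sub>R y"] by (simp flip: t(3))
    ultimately have rest: "sum t (X - {x}) = 1 - t x" "(\<Sum>y\<in>X - {x}. t y *\<^sub>R y) = (1 - t x) *\<^sub>R x"
      by (simp, simp add: scaleR_diff_left eq_diff_eq add.commute)
    obtain z where "z \<in> X - {x}" "0 < t z" using t(4) by blast
    then have "0 < sum t (X - {x})" using t(1) psubset.hyps by (intro sum_pos2[of _ z]) auto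
    then have "t x < 1" using rest(1) by simp
    have "x \<in> convex hull (X - {x})"
      unfolding convex_hull_finite[OF finite_Diff[OF psubset.hyps]]
    proof (intro CollectI exI conjI ballI)
      show "0 \<le> t y / (1 - t x)" if "y \<in> X - {x}" for y using that t(1) \<open>t x < 1\<close> by simp
      show "(\<Sum>y\<in>X - {x}. t y / (1 - t x)) = 1"
        using rest(1) \<open>t x < 1\<close> by (simp flip: sum_divide_distrib)
      have "(\<Sum>y\<in>X - {x}. (t y / (1 - t x)) *\<^sub>R y) = (1 / (1 - t x)) *\<^sub>R (\<Sum>y\<in>X - {x}. t y *\<^sub>R y)"
        by (simp add: scaleR_sum_right)
      then show "(\<Sum>y\<in>X - {x}. (t y / (1 - t x)) *\<^sub>R y) = x"
        using rest(2) \<open>t x < 1\<close> by simp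
    qed
    then have "convex hull (X - {x}) = convex hull X"
      using hull_redundant[of x convex "X - {x}"] x(1) by (simp add: insert_absorb)
    then show ?thesis using psubset.IH[of "X - {x}"] x(1) by auto
  qed
qed

section \<open>Semipolytopes and finite generation\<close>

text \<open>
  Dropping zero weights shows that each point \<open>s\<close> of \<open>S\<close> is a positive combination of one of the
  finitely many sets \<open>W \<subseteq> V\<close>. For every \<open>W\<close> there are, by \<open>finite_subset_dyadic_aff\<close>,
  finitely many points of \<open>S\<close> in the convex hull of \<open>W\<close> whose dyadic affine span contains all these
  \<open>s\<close>. Together with \<open>W\<close> they generate every such \<open>s\<close>, as \<open>s\<close> is relatively interior to
  their convex hull, which is that of \<open>W\<close>.
\<close>

theorem finitely_generated_in_convex_hull:
  assumes S: "midpoint_closed S" "S \<subseteq> dyadic_space n" and V: "finite V" "V \<subseteq> S" "S \<subseteq> convex hull V"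
  shows "finitely_generated S"
proof -
  have "\<exists>X. finite X \<and> X \<subseteq> S \<inter> positive_combinations W \<union> W \<and>
      S \<inter> positive_combinations W \<union> W \<subseteq> dyadic_aff X" if "W \<subseteq> V" for W
  proof -
    have "S \<inter> positive_combinations W \<union> W \<subseteq> dyadic_space n" using S(2) V(2) that by blast
    then show ?thesis by (rule finite_subset_dyadic_aff) blast
  qed
  then obtain X where X: "\<And>W. W \<subseteq> V \<Longrightarrow> finite (X W)"
    "\<And>W. W \<subseteq> V \<Longrightarrow> X W \<subseteq> S \<inter> positive_combinations W \<union> W"
    "\<And>W. W \<subseteq> V \<Longrightarrow> S \<inter> positive_combinations W \<union> W \<subseteq> dyadic_aff (X W)"
    by metis
  define G where "G = (\<Union>W\<in>Pow V. X W \<union> W)"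
  have "finite G" using X(1) V(1) by (auto simp: G_def intro: finite_subset)
  have "X W \<union> W \<subseteq> S" if "W \<subseteq> V" for W
    using X(2)[OF that] that V(2) by blast
  then have "G \<subseteq> S" unfolding G_def by blast
  have "s \<in> midpoint_closed hull G" if s: "s \<in> S" for s
  proof -
    have "s \<in> convex hull V" using s V(3) by blast
    then obtain t where t: "\<And>v. v \<in> V \<Longrightarrow> 0 \<le> t v" "sum t V = 1" "s = (\<Sum>v\<in>V. t v *\<^sub>R v)"
      by (auto simp: convex_hull_finite[OF V(1)])
    define W where "W = {v \<in> V. 0 < t v}"
    have W: "W \<subseteq> V" "finite W" using V(1) by (auto simp: W_def)
    have "t v = 0" if "v \<in> V - W" for v using t(1)[of v] that by (auto simp: W_def)
    then have "sum t W = 1" "(\<Sum>v\<in>W. t v *\<^sub>R v) = s"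
      using sum.mono_neutral_left[OF V(1) W(1), of t] sum.mono_neutral_left[OF V(1) W(1), of "\<lambda>v. t v *\<^sub>R v"]
      by (auto simp: t(2,3))
    then have s_pos: "s \<in> positive_combinations W"
      unfolding positive_combinations_def by (intro CollectI exI[of _ t]) (auto simp: W_def)
    let ?X = "X W \<union> W"
    have fin: "finite ?X" using X(1) W by simp
    have "?X \<subseteq> convex hull W"
      using X(2)[OF W(1)] positive_combinations_subset_convex_hull[OF W(2)] hull_subset[of W convex] by blast
    then have "s \<in> positive_combinations ?X"
      using positive_combinations_superset[OF fin, of W] s_pos by blast
    moreover have "s \<in> dyadic_aff ?X"
      using X(3)[OF W(1)] s s_pos dyadic_aff_mono[of "X W" ?X] by blast
    moreover have X_G: "?X \<subseteq> G" using W(1) by (auto simp: G_def)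
    ultimately have "s \<in> midpoint_closed hull ?X"
      using positive_dyadic_affine_combination_in_hull[OF fin] \<open>G \<subseteq> S\<close> S(2) by blast
    then show ?thesis using hull_mono[OF X_G] by blast
  qed
  then have "S = midpoint_closed hull G"
    using hull_minimal[of G S midpoint_closed] \<open>G \<subseteq> S\<close> S(1) by blast
  then show ?thesis using \<open>finite G\<close> by (auto simp: finitely_generated_def)
qed

lemma convex_midpoint_closed: "convex Q \<Longrightarrow> midpoint_closed Q"
proof -
  assume Q: "convex Q"
  have "midpoint a b \<in> Q" if "a \<in> Q" "b \<in> Q" for a b
    using convexD[OF Q that, of "1 / 2" "1 / 2"] by (simp add: midpoint_def scaleR_add_right)
  then show ?thesis by (simp add: midpoint_closed_def)
qed

text \<open>
  The vertices of the surrounding polytope belong to the semipolytope and span the polytope.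
\<close>

corollary semipolytope_finitely_generated:
  assumes "semipolytope m S"
  shows "finitely_generated S"
proof -
  obtain C Q where Q: "polytope Q" "{v. v extreme_point_of Q} \<subseteq> dyadic_space m" "C = Q \<inter> dyadic_space m"
    and S: "subgroupoid S C" "groupoid_vertices S = {v. v extreme_point_of (convex hull C)}"
    using assms by (auto simp: semipolytope_def dyadic_polytope_def)
  obtain X where X: "finite X" "Q = convex hull X" using Q(1) by (auto simp: polytope_def)
  let ?V = "{v. v extreme_point_of Q}"
  have V: "finite ?V" using X extreme_point_of_convex_hull[of _ X] by (auto intro: finite_subset[of _ X])
  have Q_hull: "Q = convex hull ?V" using convex_hull_extreme_points[OF X(1)] X(2) by simp
  have "?V \<subseteq> C" using Q(2,3) by (auto simp: extreme_point_of_def)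
  then have "convex hull C = Q"
    using hull_mono[of ?V C convex] hull_minimal[of C Q convex] Q(3) Q_hull X(2) convex_convex_hull by blast
  then have "?V \<subseteq> S" using S(2) by (auto simp: groupoid_vertices_def)
  then show ?thesis
    using finitely_generated_in_convex_hull[of S m ?V] S(1) V Q(3) Q_hull by (auto simp: subgroupoid_def)
qed

text \<open>
  Suppose that a vertex \<open>v\<close> of the groupoid is not extreme. Then \<open>v\<close> is a convex combination of
  generators, some of them different from \<open>v\<close>, and by \<open>positive_combination_integral\<close> the weights may
  be taken to be \<open>p y / N\<close> with positive integers \<open>p y\<close>. Adding \<open>2 ^ N - N\<close> copies of \<open>v\<close> itself to
  the average makes the denominator a power of two, so that \<open>groupoid_vertex_average\<close> applies.
\<close>

lemma groupoid_vertices_midpoint_closed_hull: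
  assumes Y: "finite Y" "Y \<subseteq> dyadic_space m" 
  shows "groupoid_vertices (midpoint_closed hull Y) = {v. v extreme_point_of (convex hull Y)}"
proof (intro equalityI subsetI CollectI)
  have S_Q: "midpoint_closed hull Y \<subseteq> convex hull Y"
    by (rule hull_minimal, rule hull_subset, rule convex_midpoint_closed, rule convex_convex_hull)
  fix v
  show "v \<in> groupoid_vertices (midpoint_closed hull Y)" if "v \<in> {v. v extreme_point_of (convex hull Y)}"
  proof -
    have v: "v extreme_point_of (convex hull Y)" using that by simp
    then have "v \<in> midpoint_closed hull Y"
      by (rule hull_inc[OF extreme_point_of_convex_hull])
    moreover have "a = v \<and> b = v" 
      if "a \<in> midpoint_closed hull Y" "b \<in> midpoint_closed hull Y" "midpoint a b = v" for a b
    proof -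
      have "v \<notin> open_segment a b" using v that S_Q by (auto simp: extreme_point_of_def)
      then have "a = b" using that(3) by (metis midpoint_in_open_segment)
      then show ?thesis using that(3) by simp
    qed
    then have "midpoint a b = v \<longleftrightarrow> a = v \<and> b = v"
      if "a \<in> midpoint_closed hull Y" "b \<in> midpoint_closed hull Y" for a b
      using that by (metis midpoint_idem)
    ultimately show ?thesis unfolding groupoid_vertices_def by simp
  qed
  assume v: "v \<in> groupoid_vertices (midpoint_closed hull Y)"
  then have v_S: "v \<in> midpoint_closed hull Y" by (simp add: groupoid_vertices_def)
  show "v extreme_point_of (convex hull Y)"
  proof (rule ccontr)
    assume "\<not> ?thesis"
    then obtain a b where ab: "a \<in> convex hull Y" "b \<in> convex hull Y" "v \<in> open_segment a b"
      using v_S S_Q by (auto simp: extreme_point_of_def)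
    obtain t where t: "\<And>y. y \<in> Y \<Longrightarrow> 0 \<le> t y" "sum t Y = 1" "v = (\<Sum>y\<in>Y. t y *\<^sub>R y)"
      "\<exists>y\<in>Y. y \<noteq> v \<and> 0 < t y"
      by (rule open_segment_convex_hull_weights[OF Y(1) ab]) (rule that)
    obtain y where y: "y \<in> Y" "y \<noteq> v" "0 < t y" using t(4) by blast
    define W where "W = {y \<in> Y. 0 < t y}"
    have W: "W \<subseteq> Y" "finite W" using Y(1) by (auto simp: W_def)
    have "t y = 0" if "y \<in> Y - W" for y using t(1)[of y] that by (auto simp: W_def)
    then have "sum t W = 1" "(\<Sum>v\<in>W. t v *\<^sub>R v) = v"
      using sum.mono_neutral_left[OF Y(1) W(1), of t] sum.mono_neutral_left[OF Y(1) W(1), of "\<lambda>v. t v *\<^sub>R v"]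
      by (auto simp: t(2,3))
    then have v_pos: "v \<in> positive_combinations W"
      unfolding positive_combinations_def by (intro CollectI exI[of _ t]) (auto simp: W_def)
    have "midpoint_closed hull Y \<subseteq> dyadic_space m"
      by (rule hull_minimal, rule Y(2), rule midpoint_closed_dyadic_space)
    then have "v \<in> dyadic_space m" using v_S by blast
    then obtain p :: "_ \<Rightarrow> nat" where p: "\<And>y. y \<in> W \<Longrightarrow> p y > 0"
      "(\<Sum>y\<in>W. real (p y) *\<^sub>R y) = real (sum p W) *\<^sub>R v"
      using positive_combination_integral[OF W(2) _ _ v_pos, of m] W(1) Y(2) by blast
    define N where "N = sum p W"
    have "N \<le> 2 ^ N" by (rule less_imp_le, rule less_exp)
    define c where "c x = (if x \<in> W then p x else 0) + (if x = v then 2 ^ N - N else 0)" for x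
    have "sum c (insert v W) = 2 ^ N"
      using W(2) \<open>N \<le> 2 ^ N\<close> by (cases "v \<in> W") (auto simp: c_def sum.distrib N_def insert_absorb)
    moreover have "(\<Sum>x\<in>insert v W. real (c x) *\<^sub>R x) =
        (\<Sum>y\<in>W. real (p y) *\<^sub>R y) + real (2 ^ N - N) *\<^sub>R v"
    proof -
      have "(\<Sum>x\<in>insert v W. real (c x) *\<^sub>R x) =
          (\<Sum>x\<in>insert v W. if x \<in> W then real (p x) *\<^sub>R x else 0) + 
          (\<Sum>x\<in>insert v W. if x = v then real (2 ^ N - N) *\<^sub>R v else 0)"
        unfolding sum.distrib[symmetric] by (intro sum.cong) (auto simp: c_def scaleR_add_left)
      also have "(\<Sum>x\<in>insert v W. if x \<in> W then real (p x) *\<^sub>R x else 0) = (\<Sum>y\<in>W. real (p y) *\<^sub>R y)"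
        using W(2) by (intro sum.mono_neutral_cong_right) auto
      also have "(\<Sum>x\<in>insert v W. if x = v then real (2 ^ N - N) *\<^sub>R v else 0) = real (2 ^ N - N) *\<^sub>R v"
        using W(2) by (subst sum.delta) auto
      finally show ?thesis .
    qed
    then have "(\<Sum>x\<in>insert v W. real (c x) *\<^sub>R x) = 2 ^ N *\<^sub>R v"
      using \<open>N \<le> 2 ^ N\<close> by (simp add: p(2) N_def[symmetric] of_nat_diff flip: scaleR_add_left)
    then have "(1 / 2 ^ N) *\<^sub>R (\<Sum>x\<in>insert v W. real (c x) *\<^sub>R x) = v" by simp
    moreover have "insert v W \<subseteq> midpoint_closed hull Y"
      using v_S W(1) hull_subset[of Y midpoint_closed] by blast
    moreover have "y \<in> W" using y by (simp add: W_def)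
    ultimately have "y = v"
      using groupoid_vertex_average[OF midpoint_closed_hull _ _ _ v, of "insert v W" c N y] W(2) p(1)
      by (simp add: c_def)
    then show False using y(2) by simp
  qed
qed

text \<open>
  The surrounding dyadic polytope consists of the dyadic points of the convex hull of \<open>Y\<close>. That \<open>Y\<close>
  spans the whole dyadic space affinely is essential: it puts every relatively interior dyadic
  point into the dyadic affine span of \<open>Y\<close>, hence into the groupoid.
\<close>

lemma semipolytope_hull:
  assumes Y: "finite Y" "Y \<subseteq> dyadic_space m" and aff: "Y \<noteq> {} \<Longrightarrow> dyadic_space m \<subseteq> dyadic_aff Y"
  shows "semipolytope m (midpoint_closed hull Y)"
proof -
  let ?S = "midpoint_closed hull Y" and ?Q = "convex hull Y"
  let ?C = "?Q \<inter> dyadic_space m"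
  have Q_space: "?Q \<subseteq> topspace (Euclidean_space m)"
    using Y(2) by (intro hull_minimal)
      (auto simp: dyadic_space_def topspace_Euclidean_space convex_def)
  have extreme: "{v. v extreme_point_of ?Q} \<subseteq> Y" using extreme_point_of_convex_hull by blast
  have C: "dyadic_polytope m ?C"
    unfolding dyadic_polytope_def using Q_space extreme Y
    by (intro exI[of _ ?Q]) (auto simp: polytope_def)
  have Y_C: "Y \<subseteq> ?C" using Y(2) hull_subset[of Y convex] by blast
  have hull_C: "convex hull ?C = ?Q"
    using hull_mono[OF Y_C, of convex] hull_minimal[of ?C ?Q convex] convex_convex_hull by blast
  have "midpoint_closed ?C"
    using convex_midpoint_closed[OF convex_convex_hull, of Y] midpoint_closed_dyadic_space[of m]
    by (auto simp: midpoint_closed_def)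
  then have S_C: "?S \<subseteq> ?C" using hull_minimal[OF Y_C, of midpoint_closed] by blast
  then have "subgroupoid ?S ?C" using midpoint_closed_hull by (simp add: subgroupoid_def)
  moreover have "dyadic_int ?C \<subseteq> ?S"
  proof
    fix y assume "y \<in> dyadic_int ?C"
    then have y: "y \<in> dyadic_aff ?C" "y \<in> rel_interior ?Q" by (auto simp: dyadic_int_def hull_C)
    have "y \<in> dyadic_space m" using y(1) dyadic_aff_dyadic_space[of ?C m] by blast
    moreover have "Y \<noteq> {}" using y(2) by auto
    ultimately show "y \<in> ?S"
      using positive_dyadic_affine_combination_in_hull[OF Y] aff
        rel_interior_positive_combinations[OF Y(1) y(2)] by blast
  qed
  ultimately show ?thesis
    using C groupoid_vertices_midpoint_closed_hull[OF Y] unfolding semipolytope_def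
    by (intro exI[of _ ?C]) (auto simp: hull_C)
qed

section \<open>Isomorphisms\<close>

lemma groupoid_isomorphic_sym:
  assumes "midpoint_closed S" "groupoid_isomorphic S T"
  shows "groupoid_isomorphic T S"
proof -
  obtain f where f: "bij_betw f S T" "\<And>a b. a \<in> S \<Longrightarrow> b \<in> S \<Longrightarrow> f (midpoint a b) = midpoint (f a) (f b)"
    using assms(2) by (auto simp: groupoid_isomorphic_def)
  let ?g = "inv_into S f"
  have "?g (midpoint c d) = midpoint (?g c) (?g d)" if "c \<in> T" "d \<in> T" for c d
  proof -
    have cd: "?g c \<in> S" "?g d \<in> S" "f (?g c) = c" "f (?g d) = d"
      using that f(1) by (auto simp: bij_betw_def inv_into_into f_inv_into_f)
    then have "f (midpoint (?g c) (?g d)) = midpoint c d" using f(2) by simp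
    moreover have "midpoint (?g c) (?g d) \<in> S" using cd assms(1) by (auto simp: midpoint_closed_def)
    ultimately show ?thesis using f(1) by (metis bij_betw_def inv_into_f_f)
  qed
  then show ?thesis using bij_betw_inv_into[OF f(1)] by (auto simp: groupoid_isomorphic_def)
qed

lemma homomorphic_image_hull:
  assumes f: "\<And>a b. a \<in> midpoint_closed hull X \<Longrightarrow> b \<in> midpoint_closed hull X \<Longrightarrow>
    f (midpoint a b) = midpoint (f a) (f b)"
  shows "f ` (midpoint_closed hull X) = midpoint_closed hull (f ` X)"
proof
  let ?H = "midpoint_closed hull X" and ?K = "midpoint_closed hull (f ` X)"
  have closed: "midpoint a b \<in> ?H" if "a \<in> ?H" "b \<in> ?H" for a b
    using that midpoint_closed_hull[of X] unfolding midpoint_closed_def[of ?H] by blast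
  show "?K \<subseteq> f ` ?H"
  proof (rule hull_minimal)
    show "midpoint_closed (f ` ?H)"
      unfolding midpoint_closed_def[of "f ` ?H"]
    proof (clarify)
      fix a b assume "a \<in> ?H" "b \<in> ?H"
      then show "midpoint (f a) (f b) \<in> f ` ?H"
        by (intro image_eqI[of _ _ "midpoint a b"] closed) (simp_all add: f)
    qed
  qed (auto intro: hull_inc)
  have "?H \<subseteq> {a \<in> ?H. f a \<in> ?K}"
  proof (rule hull_minimal)
    have "midpoint a b \<in> ?K" if "a \<in> ?K" "b \<in> ?K" for a b
      using that midpoint_closed_hull[of "f ` X"] unfolding midpoint_closed_def[of ?K] by blast
    then show "midpoint_closed {a \<in> ?H. f a \<in> ?K}"
      unfolding midpoint_closed_def[of "{a \<in> ?H. f a \<in> ?K}"]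
      using closed f by simp
  qed (auto intro: hull_inc)
  then show "f ` ?H \<subseteq> ?K" by blast
qed

lemma finitely_generated_isomorphic:
  assumes "finitely_generated S" "groupoid_isomorphic S T"
  shows "finitely_generated T"
proof -
  obtain X where X: "finite X" "S = midpoint_closed hull X" using assms(1) by (auto simp: finitely_generated_def)
  obtain f where f: "f ` S = T" "\<And>a b. a \<in> S \<Longrightarrow> b \<in> S \<Longrightarrow> f (midpoint a b) = midpoint (f a) (f b)"
    using assms(2) by (auto simp: groupoid_isomorphic_def bij_betw_def)
  then have "T = midpoint_closed hull (f ` X)" using homomorphic_image_hull[of X f] X(2) by simp
  then show ?thesis using X(1) by (auto simp: finitely_generated_def)
qed

lemma midpoint_diff_translate:
  "midpoint u v - x = (1 / 2) *\<^sub>R ((u - x) + (v - x))" for u v x :: "nat \<Rightarrow> real"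
  by (rule ext) (simp add: midpoint_apply field_simps)

text \<open>
  In general the dyadic affine span of \<open>D\<close> misses dyadic points of its real affine span: the
  groupoid generated by 0 and 3 does not affinely span the point 1. This is why \<open>D\<close> is rewritten in
  coordinates \<open>f\<close> with respect to a basis of the module spanned by the differences of its
  generators: the images of the generators then affinely span a full dyadic space.
\<close>

lemma finitely_generated_isomorphic_semipolytope:
  assumes D: "finitely_generated D" "D \<subseteq> dyadic_space n"
  shows "\<exists>m S. semipolytope m S \<and> groupoid_isomorphic D S"
proof -
  obtain X where X: "finite X" "D = midpoint_closed hull X" using D(1) by (auto simp: finitely_generated_def)
  show ?thesis
  proof (cases "X = {}")
    case True
    have "D = {}" using X(2) True hull_minimal[of "{}" "{}" midpoint_closed] by (auto simp: midpoint_closed_def)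
    then have "groupoid_isomorphic D D" by (auto simp: groupoid_isomorphic_def bij_betw_def)
    moreover have "semipolytope 0 D" using semipolytope_hull[of "{}" 0] X(2) True by simp
    ultimately show ?thesis by blast
  next
    case False
    then obtain x0 where x0: "x0 \<in> X" by blast
    have X_D: "X \<subseteq> D" unfolding X(2) by (rule hull_subset)
    define M where "M = dyadic_submodule hull ((\<lambda>x. x - x0) ` X)"
    have M: "dyadic_submodule M" unfolding M_def by (rule dyadic_submodule_hull)
    have "M \<subseteq> dyadic_space n"
      unfolding M_def using D(2) X_D x0
      by (intro hull_minimal dyadic_submodule_dyadic_space)
        (auto intro!: dyadic_submoduleD(2)[OF dyadic_submodule_dyadic_space])
    then obtain m and b :: "nat \<Rightarrow> nat \<Rightarrow> real"
      where b: "bij_betw (\<lambda>y. \<Sum>i<m. y i *\<^sub>R b i) (dyadic_space m) M"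
      using dyadic_submodule_free[OF M] by metis
    define g where "g y = (\<Sum>i<m. y i *\<^sub>R b i)" for y :: "nat \<Rightarrow> real"
    have g: "inj_on g (dyadic_space m)" "g ` dyadic_space m = M"
      using b by (auto simp: bij_betw_def g_def[abs_def])
    have g_linear: "g (u - v) = g u - g v" "g (r *\<^sub>R u) = r *\<^sub>R g u" "g (u + v) = g u + g v" "g 0 = 0" for u v r
      by (auto simp: g_def scaleR_diff_left sum_subtractf scaleR_sum_right scaleR_add_left sum.distrib)
    have D_M: "d - x0 \<in> M" if "d \<in> D" for d
    proof -
      have "D \<subseteq> {d. d - x0 \<in> M}"
        unfolding X(2)
      proof (rule hull_minimal)
        show "X \<subseteq> {d. d - x0 \<in> M}" by (auto simp: M_def intro: hull_inc)
        show "midpoint_closed {d. d - x0 \<in> M}"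
          unfolding midpoint_closed_def mem_Collect_eq midpoint_diff_translate
          by (intro ballI allI impI dyadic_submoduleD(3,4)[OF M]) auto
      qed
      then show ?thesis using that by blast
    qed
    define f where "f d = inv_into (dyadic_space m) g (d - x0)" for d
    have f: "f d \<in> dyadic_space m" "g (f d) = d - x0" if "d \<in> D" for d
      using D_M[OF that] g(2) by (auto simp: f_def inv_into_into f_inv_into_f)
    have f_eqI: "f d = y" if "d \<in> D" "y \<in> dyadic_space m" "g y = d - x0" for d y
      using g(1) that by (metis f_def inv_into_f_f)
    have f_midpoint: "f (midpoint c d) = midpoint (f c) (f d)" if "c \<in> D" "d \<in> D" for c d
    proof (rule f_eqI)
      show "midpoint c d \<in> D" using that midpoint_closed_hull[of X] X(2) by (auto simp: midpoint_closed_def)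
      show "midpoint (f c) (f d) \<in> dyadic_space m"
        using f that midpoint_closed_dyadic_space[of m] by (auto simp: midpoint_closed_def)
      have "g (midpoint (f c) (f d)) = (1 / 2) *\<^sub>R ((c - x0) + (d - x0))"
        using f that by (simp add: midpoint_def g_linear)
      also have "\<dots> = midpoint c d - x0" by (simp only: midpoint_diff_translate)
      finally show "g (midpoint (f c) (f d)) = midpoint c d - x0" .
    qed
    have "inj_on f D" using f(2) by (intro inj_onI) (metis diff_add_cancel)
    have image: "f ` D = midpoint_closed hull (f ` X)"
      using homomorphic_image_hull[of X f] f_midpoint X(2) by simp
    have Y: "f ` X \<subseteq> dyadic_space m" using f(1) X_D by blast
    have "f x0 = 0"
      using f_eqI[of x0 0] x0 X_D dyadic_submoduleD(1)[OF dyadic_submodule_dyadic_space] by (auto simp: g_linear)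
    have "dyadic_space m \<subseteq> dyadic_aff (f ` X)"
    proof (rule subsetI, rule dyadic_aff_via_submodule)
      fix y assume y: "y \<in> dyadic_space m"
      let ?H = "dyadic_submodule hull (f ` X)"
      have H_space: "?H \<subseteq> dyadic_space m" by (rule hull_minimal, rule Y, rule dyadic_submodule_dyadic_space)
      have H: "dyadic_submodule ?H" by (rule dyadic_submodule_hull)
      have "M \<subseteq> g ` ?H"
        unfolding M_def
      proof (rule hull_minimal)
        show "(\<lambda>x. x - x0) ` X \<subseteq> g ` ?H"
        proof (clarify, rule image_eqI)
          fix x assume "x \<in> X"
          then show "x - x0 = g (f x)" "f x \<in> ?H" using f(2) X_D by (auto intro: hull_inc)
        qed
        show "dyadic_submodule (g ` ?H)"
        proof (rule dyadic_submodule_def[THEN iffD2], intro conjI ballI)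
          show "0 \<in> g ` ?H" using dyadic_submoduleD(1)[OF H] g_linear(4) by (metis image_eqI)
          show "u - v \<in> g ` ?H" if "u \<in> g ` ?H" "v \<in> g ` ?H" for u v
            using that dyadic_submoduleD(2)[OF H] by (auto simp flip: g_linear(1))
          show "(1 / 2) *\<^sub>R u \<in> g ` ?H" if "u \<in> g ` ?H" for u
            using that dyadic_submoduleD(4)[OF H] by (auto simp flip: g_linear(2))
        qed
      qed
      then obtain z where "z \<in> ?H" "g y = g z" using y g(2) by blast
      then have "y \<in> ?H" using inj_onD[OF g(1)] y H_space by (metis subsetD)
      then show "y - f x0 \<in> dyadic_submodule hull ((\<lambda>y. y - f x0) ` f ` X)" by (simp add: \<open>f x0 = 0\<close>)
    qed (use X(1) x0 in auto)
    then have "semipolytope m (f ` D)" unfolding image using X(1) Y by (intro semipolytope_hull) auto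
    moreover have "groupoid_isomorphic D (f ` D)"
      unfolding groupoid_isomorphic_def using \<open>inj_on f D\<close> f_midpoint
      by (intro exI[of _ f]) (auto simp: bij_betw_def)
    ultimately show ?thesis by blast
  qed
qed

theorem theorem5p1:
  fixes n :: nat and D :: "(nat \<Rightarrow> real) set"
  assumes "subgroupoid D (dyadic_space n)"
  shows "finitely_generated D \<longleftrightarrow> (\<exists>m S. semipolytope m S \<and> groupoid_isomorphic D S)"
proof
  assume "finitely_generated D"
  then show "\<exists>m S. semipolytope m S \<and> groupoid_isomorphic D S"
    using assms finitely_generated_isomorphic_semipolytope by (auto simp: subgroupoid_def)
next
  assume "\<exists>m S. semipolytope m S \<and> groupoid_isomorphic D S"
  then obtain m S where S: "semipolytope m S" "groupoid_isomorphic D S" by blast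
  have "finitely_generated S" by (rule semipolytope_finitely_generated[OF S(1)])
  moreover have "groupoid_isomorphic S D"
    using groupoid_isomorphic_sym[OF _ S(2)] assms by (simp add: subgroupoid_def)
  ultimately show "finitely_generated D" by (rule finitely_generated_isomorphic)
qed

end
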